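(* Let $X$ be an $r$-dimensional simplicial complex with $r\ge 2$. Then $$\lambda_{r-1}(X)=d_{r-1}^{\top}(X)$$ if and only if $f_r(X)=1$. In particular, if $X$ is pure, then $\lambda_{r-1}(X)=d_{r-1}^{\top}(X)$ if and only if $X\cong\Delta_r$, where $\Delta_r$ denotes the $r$-dimensional simplex.
   Context: A simplicial complex $X$ on a finite set $V$ is a collection of subsets of $V$ closed under taking subsets, with $\emptyset\in X$. A $k$-simplex is an element of $X$ of cardinality $k+1$; $X(k)$ is the set of $k$-simplices and $f_k(X)=|X(k)|$. The dimension of $X$ is the maximum dimension of its simplices; here it is $r$. $X$ is pure if all its inclusion-maximal simplices have dimension $r$. The vertices of $X$ are the elements $v$ with $\{v\}\in X$; $X_1\cong X_2$ means there is a bijection between the vertex sets under which a set of vertices is a simplex of $X_1$ if and only if its image is a simplex of $X_2$. $\Delta_r$ is the complex of all subsets of an $(r+1)$-element set. Each simplex is given a fixed orientation (a linear ordering of its vertices). The boundary map $\partial_r(X)$ sends the $r$-simplex $\sigma=[v_0,\dots,v_r]$ to $\sum_{j=0}^{r}(-1)^j[v_0,\dots,\widehat{v_j},\dots,v_r]$. For $\tau\in X(r-1)$, the incidence sign $(\sigma:\tau)\in\{1,-1,0\}$ is the coefficient of the oriented simplex $\tau$ in $\partial_r(X)\sigma$: it is $1$ if $\tau\subset\sigma$ and the orientation of $\tau$ agrees with the one induced by $\sigma$, $-1$ if $\tau\subset\sigma$ and it is opposite, and $0$ if $\tau\not\subset\sigma$. $B_r(X)$ is the real matrix with rows indexed by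 $X(r-1)$, columns indexed by $X(r)$, and $(\tau,\sigma)$-entry $(\sigma:\tau)$. The $(r-1)$-dimensional up-Laplacian is $L_{r-1}^{\mathrm{up}}(X)=B_r(X)B_r(X)^{\top}$, a real symmetric positive semidefinite matrix indexed by $X(r-1)$. $\lambda_{r-1}(X)=(\lambda_{r-1,1}(X),\lambda_{r-1,2}(X),\dots)$ is the sequence of its eigenvalues, with multiplicity and in weakly decreasing order. For $\tau\in X(r-1)$, $\deg_{r-1}(X;\tau)=|\{F\in X(r):\tau\subseteq F\}|$. The conjugate $(r-1)$-degree sequence is $d_{r-1}^{\top}(X)=(d_{r-1,1}^{\top}(X),d_{r-1,2}^{\top}(X),\dots)$ with $d_{r-1,j}^{\top}(X)=|\{\tau\in X(r-1):\deg_{r-1}(X;\tau)\ge j\}|$ for $j\ge1$. When two sequences are compared, they are padded with zeros whenever necessary. *)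

theory Defs
  imports "HOL-Combinatorics.Permutations" "Jordan_Normal_Form.Char_Poly"
begin

definition simplicial_complex :: "'a set \<Rightarrow> 'a set set \<Rightarrow> bool" where
  "simplicial_complex V X \<longleftrightarrow>
     finite V \<and> X \<subseteq> Pow V \<and> {} \<in> X \<and> (\<forall>\<sigma>\<in>X. \<forall>\<tau>. \<tau> \<subseteq> \<sigma> \<longrightarrow> \<tau> \<in> X)"

definition simplices :: "'a set set \<Rightarrow> nat \<Rightarrow> 'a set set" where
  "simplices X k = {\<sigma> \<in> X. card \<sigma> = k + 1}"

definition face_number :: "'a set set \<Rightarrow> nat \<Rightarrow> nat" where
  "face_number X k = card (simplices X k)"

(* Integer-valued, since the empty simplex has dimension -1. *)
definition simplex_dim :: "'a set \<Rightarrow> int" where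
  "simplex_dim \<sigma> = int (card \<sigma>) - 1"

definition complex_dim :: "'a set set \<Rightarrow> int" where
  "complex_dim X = Max (simplex_dim ` X)"

definition pure_complex :: "'a set set \<Rightarrow> bool" where
  "pure_complex X \<longleftrightarrow>
     (\<forall>\<sigma>\<in>X. (\<forall>\<tau>\<in>X. \<sigma> \<subseteq> \<tau> \<longrightarrow> \<tau> = \<sigma>) \<longrightarrow> simplex_dim \<sigma> = complex_dim X)"

definition vertices :: "'a set set \<Rightarrow> 'a set" where
  "vertices X = {v. {v} \<in> X}"

definition complex_iso :: "'a set set \<Rightarrow> 'b set set \<Rightarrow> bool" where
  "complex_iso X Y \<longleftrightarrow>
     (\<exists>f. bij_betw f (vertices X) (vertices Y) \<and>
          (\<forall>S. S \<subseteq> vertices X \<longrightarrow> (S \<in> X \<longleftrightarrow> f ` S \<in> Y)))"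

definition full_simplex :: "nat \<Rightarrow> nat set set" where
  "full_simplex r = Pow {0..r}"

definition orientation :: "'a set set \<Rightarrow> ('a set \<Rightarrow> 'a list) \<Rightarrow> bool" where
  "orientation X ornt \<longleftrightarrow> (\<forall>\<sigma>\<in>X. distinct (ornt \<sigma>) \<and> set (ornt \<sigma>) = \<sigma>)"

(* The coefficient c with [xs] = c [ys] as oriented simplices, and 0 if the vertex
   sets differ.  For distinct xs the permutation p below is unique if it exists. *)
definition orientation_sign :: "'a list \<Rightarrow> 'a list \<Rightarrow> real" where
  "orientation_sign xs ys =
     (if \<exists>p. p permutes set xs \<and> map p xs = ys \<and> evenperm p then 1
      else if \<exists>p. p permutes set xs \<and> map p xs = ys \<and> \<not> evenperm p then -1
      else 0)"

definition omit_nth :: "nat \<Rightarrow> 'a list \<Rightarrow> 'a list" where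
  "omit_nth j xs = take j xs @ drop (Suc j) xs"

(* (\<sigma> : \<tau>), the coefficient of [ornt \<tau>] in the boundary of [ornt \<sigma>]. *)
definition incidence :: "('a set \<Rightarrow> 'a list) \<Rightarrow> 'a set \<Rightarrow> 'a set \<Rightarrow> real" where
  "incidence ornt \<sigma> \<tau> =
     (\<Sum>j<length (ornt \<sigma>). (-1) ^ j * orientation_sign (omit_nth j (ornt \<sigma>)) (ornt \<tau>))"

(* Matrices are indexed by initial segments of the naturals, so the k-simplices are
   enumerated in an arbitrary order; the Laplacian spectrum does not depend on it. *)
definition simplex_list :: "'a set set \<Rightarrow> nat \<Rightarrow> 'a set list" where
  "simplex_list X k = (SOME xs. distinct xs \<and> set xs = simplices X k)"

(* B_k(X), for k \<ge> 1. *)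
definition boundary_matrix :: "('a set \<Rightarrow> 'a list) \<Rightarrow> 'a set set \<Rightarrow> nat \<Rightarrow> real mat" where
  "boundary_matrix ornt X k =
     mat (length (simplex_list X (k - 1))) (length (simplex_list X k))
       (\<lambda>(i, j). incidence ornt (simplex_list X k ! j) (simplex_list X (k - 1) ! i))"

definition up_laplacian :: "('a set \<Rightarrow> 'a list) \<Rightarrow> 'a set set \<Rightarrow> nat \<Rightarrow> real mat" where
  "up_laplacian ornt X k =
     boundary_matrix ornt X (k + 1) * transpose_mat (boundary_matrix ornt X (k + 1))"

(* Real eigenvalues with algebraic multiplicity; for a symmetric real matrix these
   are all eigenvalues, and both notions of multiplicity agree. *)
definition decreasing_eigenvalues :: "real mat \<Rightarrow> real list" where
  "decreasing_eigenvalues A = rev (sorted_list_of_multiset (proots (char_poly A)))"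

(* The sequences are indexed by j \<ge> 1; the spectrum is padded with zeros. *)
definition laplacian_eigenvalue ::
    "('a set \<Rightarrow> 'a list) \<Rightarrow> 'a set set \<Rightarrow> nat \<Rightarrow> nat \<Rightarrow> real" where
  "laplacian_eigenvalue ornt X k j =
     (let es = decreasing_eigenvalues (up_laplacian ornt X k)
      in if j - 1 < length es then es ! (j - 1) else 0)"

definition up_degree :: "'a set set \<Rightarrow> nat \<Rightarrow> 'a set \<Rightarrow> nat" where
  "up_degree X k \<tau> = card {F \<in> simplices X (k + 1). \<tau> \<subseteq> F}"

definition conjugate_degree :: "'a set set \<Rightarrow> nat \<Rightarrow> nat \<Rightarrow> nat" where
  "conjugate_degree X k j = card {\<tau> \<in> simplices X k. up_degree X k \<tau> \<ge> j}"

definition spectrum_eq_conjugate_degrees ::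
    "('a set \<Rightarrow> 'a list) \<Rightarrow> 'a set set \<Rightarrow> nat \<Rightarrow> bool" where
  "spectrum_eq_conjugate_degrees ornt X k \<longleftrightarrow>
     (\<forall>j\<ge>1. laplacian_eigenvalue ornt X k j = real (conjugate_degree X k j))"

end

theory Submission
  imports Defs
begin

text \<open>
Let \<open>F\<close> be the set of \<open>r\<close>-simplices of \<open>X\<close> and \<open>N\<close> the number of \<open>(r - 1)\<close>-simplices that lie in
some member of \<open>F\<close>. Then \<open>N\<close> is the first conjugate degree, so if the two sequences agree, \<open>N\<close> is
an eigenvalue of \<open>B B\<^sup>T\<close>, hence of the Gram matrix \<open>G = B\<^sup>T B\<close> indexed by \<open>F\<close>. The diagonal
entries of \<open>G\<close> are \<open>r + 1\<close>; the entry at \<open>\<sigma> \<noteq> \<rho>\<close> is \<open>1\<close> or \<open>-1\<close> if \<open>\<sigma>\<close> and \<open>\<rho>\<close> share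
\<open>r\<close> vertices (are neighbours) and \<open>0\<close> otherwise. At an entry of largest modulus of an
eigenvector, say at \<open>\<sigma>\<close>, the eigenvalue equation gives \<open>N \<le> r + 1 + n(\<sigma>)\<close>, where \<open>n(\<sigma>)\<close>
counts the neighbours of \<open>\<sigma>\<close>.

On the other hand \<open>N \<ge> r + 1 + n(\<sigma>)\<close> for purely combinatorial reasons
(\<open>card_shadow_ge\<close>). The simplex \<open>\<sigma>\<close> has \<open>r + 1\<close> ridges of its own. A neighbour
\<open>\<sigma> - a + v\<close> has the further ridge \<open>\<sigma> - a - s(a) + v\<close>, where \<open>s\<close> is a self-map of \<open>\<sigma>\<close> that
has neither fixed points nor 2-cycles; such an \<open>s\<close> exists as \<open>\<sigma>\<close> has at least three
vertices, and without 2-cycles the pair \<open>{a, s(a)}\<close> determines \<open>a\<close>, so these ridges are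
distinct.

Hence equality holds throughout. On the combinatorial side, playing different maps \<open>s\<close>
against each other shows that \<open>F\<close> either has one member or consists of the four triangles on
four vertices with \<open>r = 2\<close> (\<open>extremal_class\<close>). On the analytic side, equality gives
\<open>G \<sigma> \<rho> * x \<rho> = x \<sigma>\<close> for all neighbours \<open>\<rho>\<close> of \<open>\<sigma>\<close>
(\<open>maximal_entry_row_equality\<close>). In the case of four triangles, any two are neighbours, so
for two of them, \<open>\<alpha>\<close> and \<open>\<beta>\<close>, the vector with entries \<open>x \<alpha>\<close> at \<open>\<alpha>\<close>, \<open>- x \<beta>\<close> at \<open>\<beta>\<close>
and \<open>0\<close> elsewhere is an eigenvector of \<open>G\<close> for the eigenvalue \<open>2\<close>. But there every covered
edge has degree 2, so the conjugate degrees take only the values \<open>N > 2\<close> and \<open>0\<close>. Signs of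
incidence numbers matter only through their squares.

Conversely, if \<open>F\<close> has one member, then \<open>B\<close> is a single column with \<open>r + 1\<close> nonzero
entries \<open>1\<close> or \<open>-1\<close>, and \<open>B B\<^sup>T\<close> has eigenvalues \<open>r + 1, 0, \<dots>, 0\<close>
(\<open>char_poly_outer_product\<close>), which are the conjugate degrees.
\<close>

section \<open>The shadow of a uniform family\<close>

definition shadow :: "nat \<Rightarrow> 'a set set \<Rightarrow> 'a set set" where
  "shadow k F = {\<tau>. card \<tau> = k \<and> (\<exists>\<sigma>\<in>F. \<tau> \<subseteq> \<sigma>)}"

lemma shadowI: "\<sigma> \<in> F \<Longrightarrow> \<tau> \<subseteq> \<sigma> \<Longrightarrow> card \<tau> = k \<Longrightarrow> \<tau> \<in> shadow k F"
  by (auto simp: shadow_def)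

text \<open>
Such a map assigns to every vertex a second one in such a way that distinct vertices
receive distinct unordered pairs.
\<close>

definition no_short_cycle :: "'a set \<Rightarrow> ('a \<Rightarrow> 'a) \<Rightarrow> bool" where
  "no_short_cycle \<sigma> s \<longleftrightarrow> (\<forall>a\<in>\<sigma>. s a \<in> \<sigma> \<and> s a \<noteq> a \<and> s (s a) \<noteq> a)"

lemma no_short_cycle_three_cycle:
  assumes "p \<in> \<sigma>" "q \<in> \<sigma>" "t \<in> \<sigma>" "p \<noteq> q" "q \<noteq> t" "t \<noteq> p"
  shows "no_short_cycle \<sigma> (\<lambda>a. if a = p then q else if a = q then t else p)"
  using assms by (auto simp: no_short_cycle_def)

text \<open>
A set with exactly one element outside \<open>\<sigma>\<close> determines both this element and the part of
\<open>\<sigma>\<close> that it misses.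
\<close>

lemma insert_Diff_eq_insert_DiffD:
  assumes "insert v (\<sigma> - A) = insert w (\<sigma> - B)" "v \<notin> \<sigma>" "w \<notin> \<sigma>" "A \<subseteq> \<sigma>" "B \<subseteq> \<sigma>"
  shows "v = w" "A = B"
proof -
  have "insert v (\<sigma> - A) - \<sigma> = {v}" "insert w (\<sigma> - B) - \<sigma> = {w}" using assms by blast+
  then show "v = w" using assms(1) by simp
  have "\<sigma> - insert v (\<sigma> - A) = A" "\<sigma> - insert w (\<sigma> - B) = B" using assms by blast+
  then show "A = B" using assms(1) by simp
qed

locale uniform_family =
  fixes F :: "'a set set" and r :: nat
  assumes finite_family: "finite F"
    and member_card: "\<sigma> \<in> F \<Longrightarrow> card \<sigma> = Suc r"
    and r_ge_2: "2 \<le> r"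
begin

definition neighbours :: "'a set \<Rightarrow> 'a set set" where
  "neighbours \<sigma> = {\<rho> \<in> F. card (\<sigma> \<inter> \<rho>) = r}"

text \<open>
Equality in the lower bound for the shadow that is proved below.
\<close>

definition extremal :: "'a set \<Rightarrow> bool" where
  "extremal \<sigma> \<longleftrightarrow> card (shadow r F) = Suc r + card (neighbours \<sigma>)"

lemma member_finite: "\<sigma> \<in> F \<Longrightarrow> finite \<sigma>"
  using member_card card.infinite by fastforce

lemma finite_shadow: "finite (shadow r F)"
proof (rule finite_subset)
  show "shadow r F \<subseteq> Pow (\<Union>F)" by (auto simp: shadow_def)
  show "finite (Pow (\<Union>F))" using finite_family member_finite by simp
qed

lemma neighbour_iff_exchange:
  assumes "\<sigma> \<in> F"
  shows "\<rho> \<in> neighbours \<sigma> \<longleftrightarrow>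
    (\<exists>a v. a \<in> \<sigma> \<and> v \<notin> \<sigma> \<and> \<rho> = insert v (\<sigma> - {a}) \<and> \<rho> \<in> F)"
proof
  assume "\<rho> \<in> neighbours \<sigma>"
  then have \<rho>: "\<rho> \<in> F" and c: "card (\<sigma> \<inter> \<rho>) = r" by (auto simp: neighbours_def)
  have "card (\<sigma> - \<rho>) = 1" "card (\<rho> - \<sigma>) = 1"
    using c member_card[OF \<rho>] member_card[OF assms] member_finite[OF \<rho>] member_finite[OF assms]
    by (simp_all add: card_Diff_subset_Int Int_commute)
  then obtain a v where "\<sigma> - \<rho> = {a}" "\<rho> - \<sigma> = {v}" by (auto simp: card_1_singleton_iff)
  then have "a \<in> \<sigma> \<and> v \<notin> \<sigma> \<and> \<rho> = insert v (\<sigma> - {a})" by blast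
  with \<rho> show "\<exists>a v. a \<in> \<sigma> \<and> v \<notin> \<sigma> \<and> \<rho> = insert v (\<sigma> - {a}) \<and> \<rho> \<in> F" by blast
next
  assume "\<exists>a v. a \<in> \<sigma> \<and> v \<notin> \<sigma> \<and> \<rho> = insert v (\<sigma> - {a}) \<and> \<rho> \<in> F"
  then obtain a v where *: "a \<in> \<sigma>" "v \<notin> \<sigma>" "\<rho> = insert v (\<sigma> - {a})" "\<rho> \<in> F" by blast
  then have "\<sigma> \<inter> \<rho> = \<sigma> - {a}" by blast
  then show "\<rho> \<in> neighbours \<sigma>"
    using * member_card[OF assms] by (simp add: neighbours_def)
qed

text \<open>
For a neighbour \<open>\<rho> = \<sigma> - a + v\<close> the vertex \<open>a\<close> is the unique element of \<open>\<sigma> - \<rho>\<close>, so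
this is the ridge \<open>\<sigma> - a - s a + v\<close> of \<open>\<rho>\<close>; it contains \<open>v\<close> and is not a ridge of \<open>\<sigma>\<close>.
\<close>

definition outer_ridge :: "('a \<Rightarrow> 'a) \<Rightarrow> 'a set \<Rightarrow> 'a set \<Rightarrow> 'a set" where
  "outer_ridge s \<sigma> \<rho> = \<rho> - {s (the_elem (\<sigma> - \<rho>))}"

lemma outer_ridge_exchange:
  assumes "a \<in> \<sigma>" "v \<notin> \<sigma>" "s a \<in> \<sigma>"
  shows "outer_ridge s \<sigma> (insert v (\<sigma> - {a})) = insert v (\<sigma> - {a, s a})"
proof -
  have "\<sigma> - insert v (\<sigma> - {a}) = {a}" using assms by blast
  then show ?thesis using assms by (auto simp: outer_ridge_def)
qed

text \<open>
The ridge \<open>\<sigma> - a - s a + v\<close> reveals \<open>v\<close> and the pair \<open>{a, s a}\<close>. If another \<open>b\<close> had the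
same pair, then \<open>b = s a\<close> and \<open>a = s b\<close>, a 2-cycle of \<open>s\<close>.
\<close>

lemma outer_ridge_inj:
  assumes "\<sigma> \<in> F" and s: "no_short_cycle \<sigma> s"
  shows "inj_on (outer_ridge s \<sigma>) (neighbours \<sigma>)"
proof (rule inj_onI)
  fix \<rho> \<rho>' assume "\<rho> \<in> neighbours \<sigma>" "\<rho>' \<in> neighbours \<sigma>"
    and eq: "outer_ridge s \<sigma> \<rho> = outer_ridge s \<sigma> \<rho>'"
  then obtain a v b w where
    av: "a \<in> \<sigma>" "v \<notin> \<sigma>" "\<rho> = insert v (\<sigma> - {a})" and
    bw: "b \<in> \<sigma>" "w \<notin> \<sigma>" "\<rho>' = insert w (\<sigma> - {b})"
    using neighbour_iff_exchange[OF assms(1)] by metis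
  have s': "s a \<in> \<sigma>" "s b \<in> \<sigma>" "s (s a) \<noteq> a"
    using s av(1) bw(1) by (auto simp: no_short_cycle_def)
  have e: "insert v (\<sigma> - {a, s a}) = insert w (\<sigma> - {b, s b})"
    using eq av bw s' by (simp add: outer_ridge_exchange)
  have "v = w" by (rule insert_Diff_eq_insert_DiffD(1)[OF e]) (use av bw s' in auto)
  moreover have "{a, s a} = {b, s b}"
    by (rule insert_Diff_eq_insert_DiffD(2)[OF e]) (use av bw s' in auto)
  then have "a = b" using s'(3) by (metis doubleton_eq_iff)
  ultimately show "\<rho> = \<rho>'" using av bw by simp
qed

lemma outer_ridge_in_shadow:
  assumes "\<sigma> \<in> F" and s: "no_short_cycle \<sigma> s" and "\<rho> \<in> neighbours \<sigma>"
  shows "outer_ridge s \<sigma> \<rho> \<in> shadow r F" "\<not> outer_ridge s \<sigma> \<rho> \<subseteq> \<sigma>"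
proof -
  obtain a v where av: "a \<in> \<sigma>" "v \<notin> \<sigma>" "\<rho> = insert v (\<sigma> - {a})" "\<rho> \<in> F"
    using neighbour_iff_exchange[OF assms(1)] assms(3) by metis
  have s': "s a \<in> \<sigma>" "s a \<noteq> a" using s av(1) by (auto simp: no_short_cycle_def)
  have e: "outer_ridge s \<sigma> \<rho> = insert v (\<sigma> - {a, s a})"
    unfolding av(3) by (rule outer_ridge_exchange[of a \<sigma> v s, OF av(1,2) s'(1)])
  show "\<not> outer_ridge s \<sigma> \<rho> \<subseteq> \<sigma>" using e av by blast
  have "card (\<sigma> - {a, s a}) = r - 1"
    using av(1) s' member_card[OF assms(1)] by (simp add: card_Diff_subset)
  then have card: "card (insert v (\<sigma> - {a, s a})) = r"
    using av(2) member_finite[OF assms(1)] r_ge_2 by simp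
  have "insert v (\<sigma> - {a, s a}) \<subseteq> \<rho>" unfolding av(3) by blast
  then show "outer_ridge s \<sigma> \<rho> \<in> shadow r F"
    unfolding e by (rule shadowI[OF av(4) _ card])
qed

lemma ex_no_short_cycle:
  assumes "\<sigma> \<in> F" obtains s where "no_short_cycle \<sigma> s"
proof -
  have "\<exists>T\<subseteq>\<sigma>. card T = 3"
    using member_card[OF assms] r_ge_2 by (metis Suc_le_mono numeral_3_eq_3 numeral_2_eq_2 obtain_subset_with_card_n)
  then obtain p q t where "{p, q, t} \<subseteq> \<sigma>" "p \<noteq> q" "q \<noteq> t" "t \<noteq> p"
    by (auto simp: card_3_iff)
  then show ?thesis using no_short_cycle_three_cycle[of p \<sigma> q t] that by blast
qed

lemma outer_ridges_in_shadow:
  assumes "\<sigma> \<in> F" and s: "no_short_cycle \<sigma> s"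
  defines "A \<equiv> {\<tau>. \<tau> \<subseteq> \<sigma> \<and> card \<tau> = r} \<union> outer_ridge s \<sigma> ` neighbours \<sigma>"
  shows "A \<subseteq> shadow r F" "card A = Suc r + card (neighbours \<sigma>)"
proof -
  show "A \<subseteq> shadow r F"
    using outer_ridge_in_shadow[OF assms(1,2)] assms(1) by (auto simp: A_def shadow_def)
  have "card {\<tau>. \<tau> \<subseteq> \<sigma> \<and> card \<tau> = r} = Suc r"
    using n_subsets[OF member_finite[OF assms(1)]] member_card[OF assms(1)] by simp
  moreover have "card (outer_ridge s \<sigma> ` neighbours \<sigma>) = card (neighbours \<sigma>)"
    by (rule card_image) (rule outer_ridge_inj[OF assms(1,2)])
  moreover have "{\<tau>. \<tau> \<subseteq> \<sigma> \<and> card \<tau> = r} \<inter> outer_ridge s \<sigma> ` neighbours \<sigma> = {}"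
    using outer_ridge_in_shadow(2)[OF assms(1,2)] by blast
  moreover have "finite {\<tau>. \<tau> \<subseteq> \<sigma> \<and> card \<tau> = r}"
    using member_finite[OF assms(1)] by simp
  moreover have "finite (neighbours \<sigma>)" using finite_family by (simp add: neighbours_def)
  ultimately show "card A = Suc r + card (neighbours \<sigma>)"
    by (simp add: A_def card_Un_disjoint)
qed

text \<open>
The ridges of \<open>\<sigma>\<close> and the outer ridges of its neighbours are distinct members of the shadow.
\<close>

lemma card_shadow_ge:
  assumes "\<sigma> \<in> F"
  shows "Suc r + card (neighbours \<sigma>) \<le> card (shadow r F)"
proof -
  obtain s where s: "no_short_cycle \<sigma> s" using ex_no_short_cycle[OF assms] .
  show ?thesis
    using card_mono[OF finite_shadow outer_ridges_in_shadow(1)[OF assms s]]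
    unfolding outer_ridges_in_shadow(2)[OF assms s] .
qed

text \<open>
In the extremal case the shadow has no room for further members, whatever \<open>s\<close> was chosen.
\<close>

lemma extremal_shadow:
  assumes "\<sigma> \<in> F" "extremal \<sigma>" "no_short_cycle \<sigma> s" "\<tau> \<in> shadow r F" "\<not> \<tau> \<subseteq> \<sigma>"
  obtains a v where "a \<in> \<sigma>" "v \<notin> \<sigma>" "insert v (\<sigma> - {a}) \<in> F" "\<tau> = insert v (\<sigma> - {a, s a})"
proof -
  have "shadow r F = {\<tau>. \<tau> \<subseteq> \<sigma> \<and> card \<tau> = r} \<union> outer_ridge s \<sigma> ` neighbours \<sigma>"
    using outer_ridges_in_shadow[OF assms(1,3)] assms(2) finite_shadow
    by (metis card_subset_eq extremal_def)
  then obtain \<rho> where \<rho>: "\<rho> \<in> neighbours \<sigma>" "\<tau> = outer_ridge s \<sigma> \<rho>"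
    using assms(4,5) by blast
  then obtain a v where av: "a \<in> \<sigma>" "v \<notin> \<sigma>" "\<rho> = insert v (\<sigma> - {a})" "\<rho> \<in> F"
    using neighbour_iff_exchange[OF assms(1)] by metis
  moreover have "s a \<in> \<sigma>" using assms(3) av(1) by (auto simp: no_short_cycle_def)
  ultimately show ?thesis
    using that outer_ridge_exchange[of a \<sigma> v s] \<rho>(2) by blast
qed

text \<open>
The ridge \<open>\<sigma> - a - b + v\<close> of the neighbour \<open>\<sigma> - a + v\<close> must be the outer ridge of some
neighbour \<open>\<sigma> - c + v\<close>, so \<open>{a, b} = {c, s c}\<close>. As \<open>b \<noteq> s a\<close>, this leaves \<open>c = b\<close> only.
\<close>

lemma extremal_exchange_step:
  assumes "\<sigma> \<in> F" "extremal \<sigma>" and s: "no_short_cycle \<sigma> s"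
    and av: "a \<in> \<sigma>" "v \<notin> \<sigma>" "insert v (\<sigma> - {a}) \<in> F"
    and b: "b \<in> \<sigma>" "b \<noteq> a" "b \<noteq> s a"
  shows "s b = a" "insert v (\<sigma> - {b}) \<in> F"
proof -
  let ?\<tau> = "insert v (\<sigma> - {a, b})"
  have "card (\<sigma> - {a, b}) = r - 1"
    using av(1) b member_card[OF assms(1)] by (simp add: card_Diff_subset)
  then have "card ?\<tau> = r"
    using av(2) member_finite[OF assms(1)] r_ge_2 by simp
  then have "?\<tau> \<in> shadow r F" by (intro shadowI[OF av(3)]) auto
  moreover have "\<not> ?\<tau> \<subseteq> \<sigma>" using av by blast
  ultimately obtain c w where cw: "c \<in> \<sigma>" "w \<notin> \<sigma>" "insert w (\<sigma> - {c}) \<in> F"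
      "?\<tau> = insert w (\<sigma> - {c, s c})"
    using extremal_shadow[OF assms(1,2) s] by metis
  have sc: "s c \<in> \<sigma>" using s cw(1) by (auto simp: no_short_cycle_def)
  have "v = w" by (rule insert_Diff_eq_insert_DiffD(1)[OF cw(4)]) (use av b cw sc in auto)
  moreover have "{a, b} = {c, s c}"
    by (rule insert_Diff_eq_insert_DiffD(2)[OF cw(4)]) (use av b cw sc in auto)
  then have "c = b \<and> s b = a" using b by (metis doubleton_eq_iff)
  ultimately show "s b = a" "insert v (\<sigma> - {b}) \<in> F" using cw by auto
qed

text \<open>
The map \<open>s\<close> in the previous lemma is free. If \<open>r \<ge> 3\<close>, then \<open>\<sigma>\<close> has three vertices \<open>p, q, t\<close>
besides \<open>a\<close>, and with \<open>s\<close> cycling through them the step applied to \<open>q\<close> yields \<open>s q = a\<close>,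
which is false. If \<open>r = 2\<close>, the map \<open>s\<close> can be the 3-cycle on \<open>\<sigma>\<close> in either direction, which
reaches both remaining vertices.
\<close>

lemma extremal_exchange:
  assumes "\<sigma> \<in> F" "extremal \<sigma>"
    and av: "a \<in> \<sigma>" "v \<notin> \<sigma>" "insert v (\<sigma> - {a}) \<in> F"
  shows "r = 2" "\<And>c. c \<in> \<sigma> \<Longrightarrow> insert v (\<sigma> - {c}) \<in> F"
proof -
  have card: "card (\<sigma> - {a}) = r" using av(1) member_card[OF assms(1)] by simp
  show r2: "r = 2"
  proof (rule ccontr)
    assume "r \<noteq> 2"
    then have "\<exists>T\<subseteq>\<sigma> - {a}. card T = 3"
      using card r_ge_2 by (metis eval_nat_numeral(3) le_neq_implies_less obtain_subset_with_card_n Suc_leI)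
    then obtain p q t where *: "{p, q, t} \<subseteq> \<sigma> - {a}" "p \<noteq> q" "q \<noteq> t" "t \<noteq> p"
      by (auto simp: card_3_iff)
    define s where "s b = (if b = p then q else if b = q then t else p)" for b
    have "no_short_cycle \<sigma> s"
      unfolding s_def by (rule no_short_cycle_three_cycle) (use * in auto)
    then have "s q = a"
      by (rule extremal_exchange_step(1)[OF assms(1,2) _ av]) (use * in \<open>auto simp: s_def\<close>)
    then show False using * by (auto simp: s_def)
  qed
  fix c assume c: "c \<in> \<sigma>"
  show "insert v (\<sigma> - {c}) \<in> F"
  proof (cases "c = a")
    case False
    have "card (\<sigma> - {a} - {c}) = 1" using card c False r2 by simp
    then obtain p where p: "\<sigma> - {a} - {c} = {p}" by (auto simp: card_1_singleton_iff)
    define s where "s b = (if b = a then p else if b = p then c else a)" for b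
    have "no_short_cycle \<sigma> s"
      unfolding s_def by (rule no_short_cycle_three_cycle) (use p c av False in auto)
    then show ?thesis
      by (rule extremal_exchange_step(2)[OF assms(1,2) _ av c])
        (use p False in \<open>auto simp: s_def\<close>)
  qed (use av in simp)
qed

text \<open>
A neighbour-closed class of extremal simplices is everything. If \<open>\<sigma>\<close> in the class has no
neighbour, all ridges lie in \<open>\<sigma>\<close> and \<open>F = {\<sigma>}\<close>. Otherwise all exchanges of a vertex of the
triangle \<open>\<sigma>\<close> for \<open>v\<close> lie in \<open>F\<close>. A second outer vertex \<open>w\<close> is impossible: an exchange at a
neighbour of \<open>\<sigma>\<close>, which is extremal as well, would put the edge \<open>{v, w}\<close> into the shadow,
although every edge in the shadow has at most one vertex outside \<open>\<sigma>\<close>.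
\<close>

lemma extremal_class:
  assumes M: "M \<subseteq> F" "\<And>\<sigma>. \<sigma> \<in> M \<Longrightarrow> extremal \<sigma>" "\<And>\<sigma>. \<sigma> \<in> M \<Longrightarrow> neighbours \<sigma> \<subseteq> M"
    and "M \<noteq> {}" and "card F \<noteq> 1"
  obtains T where "card T = 4" "r = 2" "F = {\<rho>. \<rho> \<subseteq> T \<and> card \<rho> = 3}" "M = F"
proof -
  obtain \<sigma> where \<sigma>: "\<sigma> \<in> M" "\<sigma> \<in> F" using assms by blast
  note ext = M(2)[OF \<sigma>(1)]
  obtain s where s: "no_short_cycle \<sigma> s" using ex_no_short_cycle[OF \<sigma>(2)] .
  have sh: "\<exists>v. v \<notin> \<sigma> \<and> \<tau> - \<sigma> = {v} \<and> (\<exists>a\<in>\<sigma>. insert v (\<sigma> - {a}) \<in> F)"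
    if \<tau>: "\<tau> \<in> shadow r F" "\<not> \<tau> \<subseteq> \<sigma>" for \<tau>
  proof -
    obtain a v where *: "a \<in> \<sigma>" "v \<notin> \<sigma>" "insert v (\<sigma> - {a}) \<in> F"
        "\<tau> = insert v (\<sigma> - {a, s a})"
      using extremal_shadow[OF \<sigma>(2) ext s \<tau>] by metis
    have "\<tau> - \<sigma> = {v}" using *(2) unfolding *(4) by blast
    then show ?thesis using *(1-3) by (intro exI[of _ v] conjI bexI[of _ a])
  qed
  \<comment> \<open>Any two vertices of a member lie on a common ridge of it, as it has at least three vertices.\<close>
  have ridge: "\<exists>\<tau>\<in>shadow r F. x \<in> \<tau> \<and> y \<in> \<tau> \<and> \<tau> \<subseteq> \<rho>" if "\<rho> \<in> F" "x \<in> \<rho>" "y \<in> \<rho>" for \<rho> x y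
  proof -
    have "card {x, y} < card \<rho>"
      using r_ge_2 member_card[OF that(1)] by (simp add: card_insert_if)
    then obtain z where z: "z \<in> \<rho>" "z \<noteq> x" "z \<noteq> y"
      by (metis card_mono finite.emptyI finite.insertI insert_iff linorder_not_less subsetI)
    have "card (\<rho> - {z}) = r" using z member_card[OF that(1)] by simp
    then show ?thesis using that z
      by (intro bexI[of _ "\<rho> - {z}"] shadowI[of \<rho>]) auto
  qed
  have "\<exists>v. v \<notin> \<sigma> \<and> (\<exists>a\<in>\<sigma>. insert v (\<sigma> - {a}) \<in> F)"
  proof (rule ccontr)
    assume no: "\<not> ?thesis"
    have "\<rho> \<subseteq> \<sigma>" if "\<rho> \<in> F" for \<rho>
      using ridge[OF that] sh no by (meson subset_iff)
    then have "\<rho> = \<sigma>" if "\<rho> \<in> F" for \<rho>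
      using that \<sigma>(2) member_card member_finite by (metis card_subset_eq)
    then have "F = {\<sigma>}" using \<sigma> by blast
    then show False using \<open>card F \<noteq> 1\<close> by simp
  qed
  then obtain v a where av: "v \<notin> \<sigma>" "a \<in> \<sigma>" "insert v (\<sigma> - {a}) \<in> F" by blast
  note r2 = extremal_exchange(1)[OF \<sigma>(2) ext av(2,1,3)]
  note all = extremal_exchange(2)[OF \<sigma>(2) ext]
  have unique: "w = v" if w: "w \<notin> \<sigma>" "b \<in> \<sigma>" "insert w (\<sigma> - {b}) \<in> F" for w b
  proof (rule ccontr)
    assume "w \<noteq> v"
    let ?\<rho> = "insert v (\<sigma> - {a})"
    have "?\<rho> \<in> neighbours \<sigma>" using neighbour_iff_exchange[OF \<sigma>(2)] av by metis
    then have ext': "extremal ?\<rho>" using M(2,3) \<sigma> by blast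
    have "card (\<sigma> - {a}) = 2" using r2 av member_card[OF \<sigma>(2)] by simp
    then obtain d where d: "d \<in> \<sigma> - {a}" by (metis all_not_in_conv card.empty zero_neq_numeral)
    \<comment> \<open>Seen from \<open>?\<rho>\<close>, this triangle exchanges \<open>v\<close> for \<open>w\<close>; exchanging \<open>d\<close> instead keeps both.\<close>
    have "insert w (?\<rho> - {v}) = insert w (\<sigma> - {a})" using av(1) by auto
    then have "insert w (?\<rho> - {v}) \<in> F" using all[OF w(2,1,3) av(2)] by simp
    then have "insert w (?\<rho> - {d}) \<in> F"
      using extremal_exchange(2)[OF av(3) ext', of v w d] w \<open>w \<noteq> v\<close> d by auto
    then obtain \<tau> where \<tau>: "\<tau> \<in> shadow r F" "v \<in> \<tau>" "w \<in> \<tau>"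
      using ridge[of "insert w (?\<rho> - {d})" v w] d av(1) by blast
    have "\<not> \<tau> \<subseteq> \<sigma>" using \<tau>(2) av(1) by blast
    then obtain u where u: "\<tau> - \<sigma> = {u}" using sh[OF \<tau>(1)] by metis
    have "v \<in> \<tau> - \<sigma>" "w \<in> \<tau> - \<sigma>" using \<tau> av(1) w(1) by simp_all
    then show False using u \<open>w \<noteq> v\<close> by simp
  qed
  let ?T = "insert v \<sigma>"
  have T: "card ?T = 4" using av member_card[OF \<sigma>(2)] member_finite[OF \<sigma>(2)] r2 by simp
  have sub: "\<rho> \<subseteq> ?T" if \<rho>: "\<rho> \<in> F" for \<rho>
  proof
    fix x assume "x \<in> \<rho>"
    then obtain \<tau> where \<tau>: "\<tau> \<in> shadow r F" "x \<in> \<tau>" using ridge[OF \<rho>] by metis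
    show "x \<in> ?T"
    proof (cases "x \<in> \<sigma>")
      case False
      then have "\<not> \<tau> \<subseteq> \<sigma>" using \<tau>(2) by blast
      then obtain u b where u: "u \<notin> \<sigma>" "\<tau> - \<sigma> = {u}" "b \<in> \<sigma>" "insert u (\<sigma> - {b}) \<in> F"
        using sh[OF \<tau>(1)] by metis
      have "x \<in> \<tau> - \<sigma>" using False \<tau>(2) by simp
      then show ?thesis using u unique[OF u(1,3,4)] by simp
    qed simp
  qed
  have mem: "\<rho> \<in> M" if "\<rho> \<subseteq> ?T" "card \<rho> = 3" for \<rho>
  proof -
    have "card (?T - \<rho>) = 1"
      using that T by (simp add: card_Diff_subset card_ge_0_finite)
    then obtain c where c: "?T - \<rho> = {c}" by (auto simp: card_1_singleton_iff)
    show ?thesis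
    proof (cases "c = v")
      case True
      have "\<rho> = ?T - {c}" using c that(1) by blast
      then have "\<rho> = \<sigma>" using True av(1) by simp
      then show ?thesis using \<sigma> by simp
    next
      case False
      then have c': "c \<in> \<sigma>" using c by blast
      have "\<rho> = ?T - {c}" using c that(1) by blast
      also have "\<dots> = insert v (\<sigma> - {c})" using False by auto
      finally have \<rho>: "\<rho> = insert v (\<sigma> - {c})" .
      have "\<rho> \<in> F" using all[OF av(2,1,3) c'] \<rho> by simp
      then have "\<rho> \<in> neighbours \<sigma>"
        using neighbour_iff_exchange[OF \<sigma>(2)] c' av(1) \<rho> by metis
      then show ?thesis using M(3) \<sigma> by blast
    qed
  qed
  have F: "F = {\<rho>. \<rho> \<subseteq> ?T \<and> card \<rho> = 3}"
    using sub mem M(1) member_card r2 by auto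
  then have "M = F" using mem M(1) by blast
  then show ?thesis using that T r2 F by blast
qed

end

section \<open>Incidence numbers\<close>

text \<open>
For lists with the same elements, the permutation that moves one to the other exists and is
even or odd, so the sign does not vanish.
\<close>

lemma orientation_sign_square:
  assumes "distinct xs" "distinct ys"
  shows "(orientation_sign xs ys)\<^sup>2 = (if set xs = set ys then 1 else 0)"
proof (cases "set xs = set ys")
  case True
  then have "mset xs = mset ys"
    using assms by (simp add: set_eq_iff_mset_eq_distinct)
  have len: "length xs = length ys"
    using \<open>mset xs = mset ys\<close> mset_eq_length by blast
  define p where "p x = (if x \<in> set xs then the (map_of (zip xs ys) x) else x)" for x
  have nth: "p (xs ! i) = ys ! i" if "i < length xs" for i
    using that len assms by (simp add: p_def map_of_zip_nth)
  have map: "map p xs = ys"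
    using len nth by (simp add: list_eq_iff_nth_eq)
  have "bij_betw p (set xs) (set xs)"
    unfolding bij_betw_def
  proof
    have "distinct (map p xs)" using map assms by simp
    then show "inj_on p (set xs)" by (simp add: distinct_map)
    show "p ` set xs = set xs" using map True by (metis list.set_map)
  qed
  then have "p permutes set xs"
    by (rule bij_imp_permutes) (simp add: p_def)
  then show ?thesis using True map by (auto simp: orientation_sign_def)
next
  case False
  have "set (map p xs) = set xs" if "p permutes set xs" for p
    using that by (simp add: permutes_image)
  then have no: "\<not> (\<exists>p. p permutes set xs \<and> map p xs = ys \<and> Q p)" for Q
    using False by blast
  show ?thesis
    unfolding orientation_sign_def if_not_P[OF no[of evenperm]]
      if_not_P[OF no[of "\<lambda>p. \<not> evenperm p"]]
    using False by simp
qed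

lemma set_omit_nth:
  assumes "distinct xs" "j < length xs"
  shows "set (omit_nth j xs) = set xs - {xs ! j}"
proof -
  have "set (us @ vs) = set xs - {y}" if "xs = us @ y # vs" for us y vs
    using assms(1) that by auto
  from this[OF id_take_nth_drop[OF assms(2)]] show ?thesis by (simp add: omit_nth_def)
qed

lemma distinct_omit_nth:
  assumes "distinct xs"
  shows "distinct (omit_nth j xs)"
  unfolding omit_nth_def using assms
  by (simp add: distinct_append set_take_disj_set_drop_if_distinct)

text \<open>
At most one summand of the incidence number is nonzero: the one that omits the vertex of
\<open>\<sigma>\<close> outside \<open>\<tau>\<close>.
\<close>

lemma incidence_square:
  assumes "distinct (ornt \<sigma>)" "set (ornt \<sigma>) = \<sigma>" "distinct (ornt \<tau>)" "set (ornt \<tau>) = \<tau>"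
    and card: "card \<sigma> = Suc (card \<tau>)"
  shows "(incidence ornt \<sigma> \<tau>)\<^sup>2 = (if \<tau> \<subseteq> \<sigma> then 1 else 0)"
proof -
  let ?xs = "ornt \<sigma>"
  define t where "t j = (-1) ^ j * orientation_sign (omit_nth j ?xs) (ornt \<tau>)" for j
  have inc: "incidence ornt \<sigma> \<tau> = (\<Sum>j<length ?xs. t j)"
    by (simp add: incidence_def t_def)
  have t: "(t j)\<^sup>2 = (if \<sigma> - {?xs ! j} = \<tau> then 1 else 0)" if "j < length ?xs" for j
    using that assms(1-4)
    by (simp add: t_def power_mult_distrib orientation_sign_square distinct_omit_nth
        set_omit_nth flip: power_mult)
  have fin: "finite \<sigma>" using assms(2) by (metis List.finite_set)
  show ?thesis
  proof (cases "\<tau> \<subseteq> \<sigma>")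
    case False
    then have "t j = 0" if "j < length ?xs" for j using t[OF that] by (auto split: if_splits)
    then show ?thesis using False by (simp add: inc)
  next
    case True
    have "card (\<sigma> - \<tau>) = 1"
      using card True fin by (simp add: card_Diff_subset finite_subset)
    then obtain a where a: "\<sigma> - \<tau> = {a}" by (auto simp: card_1_singleton_iff)
    then obtain k where k: "k < length ?xs" "?xs ! k = a"
      using assms(2) by (metis Diff_iff in_set_conv_nth insertI1)
    have "t j = 0" if "j < length ?xs" "j \<noteq> k" for j
    proof -
      have "?xs ! j \<noteq> a" using that k assms(1) by (metis nth_eq_iff_index_eq)
      then have "a \<in> \<sigma> - {?xs ! j}" "a \<notin> \<tau>" using a by auto
      then have "\<sigma> - {?xs ! j} \<noteq> \<tau>" by blast
      then show ?thesis using t[OF that(1)] by simp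
    qed
    then have "incidence ornt \<sigma> \<tau> = t k"
      unfolding inc using k by (subst sum.remove[of _ k]) auto
    moreover have "\<sigma> - {?xs ! k} = \<tau>" unfolding k(2) using a True by auto
    ultimately show ?thesis using t[OF k(1)] True by simp
  qed
qed

section \<open>Eigenvalues of Gram matrices\<close>

lemma sum_nth_eq_sum_set:
  assumes "distinct xs"
  shows "(\<Sum>i<length xs. f (xs ! i)) = sum f (set xs)"
  using sum.reindex_bij_betw[OF bij_betw_nth[OF assms refl refl]] .

text \<open>
If \<open>v\<close> is an eigenvector of \<open>A * B\<close>, then \<open>B v\<close> is one of \<open>B * A\<close>; it is nonzero since
\<open>A (B v) = k v\<close> is.
\<close>

lemma eigenvalue_mult_commute:
  fixes A B :: "'a :: field mat"
  assumes A: "A \<in> carrier_mat n m" and B: "B \<in> carrier_mat m n"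
    and k: "k \<noteq> 0" "eigenvalue (A * B) k"
  shows "eigenvalue (B * A) k"
proof -
  obtain v where v: "v \<in> carrier_vec n" "v \<noteq> 0\<^sub>v n" "(A * B) *\<^sub>v v = k \<cdot>\<^sub>v v"
    using k(2) A by (auto simp: eigenvalue_def eigenvector_def)
  have Bv: "B *\<^sub>v v \<in> carrier_vec m" using B v by simp
  have ABv: "A *\<^sub>v (B *\<^sub>v v) = k \<cdot>\<^sub>v v" using A B v by (simp add: assoc_mult_mat_vec)
  have "B *\<^sub>v v \<noteq> 0\<^sub>v m"
  proof
    assume "B *\<^sub>v v = 0\<^sub>v m"
    moreover have "A *\<^sub>v 0\<^sub>v m = 0\<^sub>v n" using A by (intro eq_vecI) auto
    ultimately have "k \<cdot>\<^sub>v v = 0\<^sub>v n" using ABv by simp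
    then have "(k \<cdot>\<^sub>v v) $ i = 0" if "i < n" for i using that by simp
    then have "v = 0\<^sub>v n" using v(1) k(1) by (intro eq_vecI) auto
    then show False using v(2) by simp
  qed
  moreover have "(B * A) *\<^sub>v (B *\<^sub>v v) = k \<cdot>\<^sub>v (B *\<^sub>v v)"
    using A B Bv ABv v by (simp add: assoc_mult_mat_vec mult_mat_vec)
  ultimately show ?thesis
    using A B Bv by (auto simp: eigenvalue_def eigenvector_def)
qed

text \<open>
An eigenvector of a matrix whose rows and columns enumerate a set is a function on this set;
this removes the enumeration from all later arguments.
\<close>

lemma eigenvalue_indexed_mat_iff:
  fixes g :: "'b \<Rightarrow> 'b \<Rightarrow> 'a :: field"
  assumes "distinct xs"
  shows "eigenvalue (mat (length xs) (length xs) (\<lambda>(i, j). g (xs ! i) (xs ! j))) k \<longleftrightarrow>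
    (\<exists>x. (\<exists>a\<in>set xs. x a \<noteq> 0) \<and> (\<forall>a\<in>set xs. (\<Sum>b\<in>set xs. g a b * x b) = k * x a))"
    (is "eigenvalue ?M k \<longleftrightarrow> ?R")
proof -
  let ?n = "length xs"
  have row: "(?M *\<^sub>v vec ?n (\<lambda>i. x (xs ! i))) $ i = (\<Sum>b\<in>set xs. g (xs ! i) b * x b)"
    if "i < ?n" for i x
    using that sum_nth_eq_sum_set[OF assms, of "\<lambda>b. g (xs ! i) b * x b"]
    by (simp add: scalar_prod_def atLeast0LessThan)
  show ?thesis
  proof
    assume "eigenvalue ?M k"
    then obtain v where v: "v \<in> carrier_vec ?n" "v \<noteq> 0\<^sub>v ?n" "?M *\<^sub>v v = k \<cdot>\<^sub>v v"
      by (auto simp: eigenvalue_def eigenvector_def)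
    define x where "x a = v $ (inv_into {..<?n} (nth xs) a)" for a
    have inj: "inj_on (nth xs) {..<?n}" using assms by (simp add: inj_on_def nth_eq_iff_index_eq)
    have x: "x (xs ! i) = v $ i" if "i < ?n" for i
      using that inv_into_f_f[OF inj] by (simp add: x_def)
    have v_eq: "v = vec ?n (\<lambda>i. x (xs ! i))" using v(1) x by (intro eq_vecI) auto
    have "\<exists>i<?n. v $ i \<noteq> 0"
    proof (rule ccontr)
      assume "\<not> ?thesis"
      then have "v = 0\<^sub>v ?n" using v(1) by (intro eq_vecI) auto
      then show False using v(2) by simp
    qed
    then have "\<exists>a\<in>set xs. x a \<noteq> 0" using x by (metis nth_mem)
    moreover have "(\<Sum>b\<in>set xs. g (xs ! i) b * x b) = k * x (xs ! i)" if "i < ?n" for i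
      using row[OF that, of x] v(1) x[OF that] that unfolding v_eq[symmetric] v(3) by simp
    then have "\<forall>a\<in>set xs. (\<Sum>b\<in>set xs. g a b * x b) = k * x a"
      by (metis in_set_conv_nth)
    ultimately show ?R by blast
  next
    assume ?R
    then obtain x a where a: "a \<in> set xs" "x a \<noteq> 0"
      and x: "\<forall>a\<in>set xs. (\<Sum>b\<in>set xs. g a b * x b) = k * x a" by blast
    let ?v = "vec ?n (\<lambda>i. x (xs ! i))"
    obtain i where i: "i < ?n" "xs ! i = a" using a by (metis in_set_conv_nth)
    then have "?v $ i \<noteq> 0\<^sub>v ?n $ i" using a by simp
    then have "?v \<noteq> 0\<^sub>v ?n" by metis
    moreover have "?M *\<^sub>v ?v = k \<cdot>\<^sub>v ?v"
    proof (rule eq_vecI)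
      fix i assume "i < dim_vec (k \<cdot>\<^sub>v ?v)"
      then have "i < ?n" by simp
      then show "(?M *\<^sub>v ?v) $ i = (k \<cdot>\<^sub>v ?v) $ i" using row x by simp
    qed simp
    ultimately show "eigenvalue ?M k"
      unfolding eigenvalue_def eigenvector_def by (intro exI[of _ ?v]) simp
  qed
qed

text \<open>
The determinant of the bordered matrix with rows \<open>(X I, b)\<close> and \<open>(b\<^sup>T, 1)\<close> is computed by two
block eliminations. Clearing \<open>b\<close> with the last row gives the characteristic polynomial of
\<open>b b\<^sup>T\<close>. Clearing \<open>b\<^sup>T\<close> with the first rows, after multiplying the last row by \<open>X\<close> to avoid
fractions, gives \<open>X\<^sup>n (X - b\<^sup>T b)\<close>; this multiplication accounts for the factor on the left.
\<close>

lemma char_poly_outer_product: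
  fixes b :: "'a :: idom mat"
  assumes b: "b \<in> carrier_mat n 1"
  shows "[:0, 1:] * char_poly (b * transpose_mat b) =
    [:0, 1:] ^ n * [:- ((transpose_mat b * b) $$ (0, 0)), 1:]"
proof -
  let ?p = "\<lambda>a :: 'a. [:a:]" let ?x = "[:0, 1:] :: 'a poly"
  let ?b = "map_mat ?p b" let ?bt = "transpose_mat ?b"
  let ?I = "1\<^sub>m n :: 'a poly mat" let ?J = "1\<^sub>m 1 :: 'a poly mat"
  let ?M = "four_block_mat (?x \<cdot>\<^sub>m ?I) ?b ?bt ?J"
  have c: "?b \<in> carrier_mat n 1" "?bt \<in> carrier_mat 1 n" "?I \<in> carrier_mat n n"
    "?J \<in> carrier_mat 1 1" "?x \<cdot>\<^sub>m ?I \<in> carrier_mat n n" "0\<^sub>m 1 n \<in> carrier_mat 1 n"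
    "0\<^sub>m n 1 \<in> carrier_mat n 1" "- ?b \<in> carrier_mat n 1" "- ?bt \<in> carrier_mat 1 n"
    "?x \<cdot>\<^sub>m ?J \<in> carrier_mat 1 1"
    using b by auto
  have M: "?M \<in> carrier_mat (n + 1) (n + 1)"
    by (rule four_block_carrier_mat[OF c(5,4)])
  have cp: "char_poly_matrix (b * transpose_mat b) = ?x \<cdot>\<^sub>m ?I + (- ?b) * ?bt"
    using b by (intro eq_matI) (auto simp: char_poly_matrix_def scalar_prod_def)
  have z: "- ?bt * (?x \<cdot>\<^sub>m ?I) + (?x \<cdot>\<^sub>m ?J) * ?bt = 0\<^sub>m 1 n"
    using b by (intro eq_matI) (auto simp: scalar_prod_def sum.remove if_distrib cong: if_cong)
  have "four_block_mat ?I (- ?b) (0\<^sub>m 1 n) ?J * ?M =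
      four_block_mat (?I * (?x \<cdot>\<^sub>m ?I) + (- ?b) * ?bt) (?I * ?b + (- ?b) * ?J)
        (0\<^sub>m 1 n * (?x \<cdot>\<^sub>m ?I) + ?J * ?bt) (0\<^sub>m 1 n * ?b + ?J * ?J)"
    by (rule mult_four_block_mat[OF c(3,8,6,4,5,1,2,4)])
  also have "?I * (?x \<cdot>\<^sub>m ?I) + (- ?b) * ?bt = char_poly_matrix (b * transpose_mat b)"
    using cp c by simp
  also have "?I * ?b + (- ?b) * ?J = 0\<^sub>m n 1"
    using c by (intro eq_matI) auto
  also have "0\<^sub>m 1 n * (?x \<cdot>\<^sub>m ?I) + ?J * ?bt = ?bt" using c by simp
  also have "0\<^sub>m 1 n * ?b + ?J * ?J = ?J" using c by simp
  finally have one: "four_block_mat ?I (- ?b) (0\<^sub>m 1 n) ?J * ?M =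
      four_block_mat (char_poly_matrix (b * transpose_mat b)) (0\<^sub>m n 1) ?bt ?J" .
  have "det (four_block_mat ?I (- ?b) (0\<^sub>m 1 n) ?J) = 1"
    by (subst det_four_block_mat_lower_left_zero[OF c(3,8) refl c(4)]) simp
  moreover have "four_block_mat ?I (- ?b) (0\<^sub>m 1 n) ?J \<in> carrier_mat (n + 1) (n + 1)"
    by (rule four_block_carrier_mat[OF c(3,4)])
  moreover have "char_poly_matrix (b * transpose_mat b) \<in> carrier_mat n n" using b by simp
  ultimately have det1: "det ?M = char_poly (b * transpose_mat b)"
    using arg_cong[OF one, of det] M c det_four_block_mat_upper_right_zero[OF _ refl c(2,4)]
    by (simp add: det_mult char_poly_def)
  have "four_block_mat ?I (0\<^sub>m n 1) (- ?bt) (?x \<cdot>\<^sub>m ?J) * ?M =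
      four_block_mat (?I * (?x \<cdot>\<^sub>m ?I) + 0\<^sub>m n 1 * ?bt) (?I * ?b + 0\<^sub>m n 1 * ?J)
        (- ?bt * (?x \<cdot>\<^sub>m ?I) + (?x \<cdot>\<^sub>m ?J) * ?bt) (- ?bt * ?b + (?x \<cdot>\<^sub>m ?J) * ?J)"
    by (rule mult_four_block_mat[OF c(3,7,9,10,5,1,2,4)])
  also have "?I * (?x \<cdot>\<^sub>m ?I) + 0\<^sub>m n 1 * ?bt = ?x \<cdot>\<^sub>m ?I" using c by simp
  also have "?I * ?b + 0\<^sub>m n 1 * ?J = ?b" using c by simp
  also note z
  finally have two: "four_block_mat ?I (0\<^sub>m n 1) (- ?bt) (?x \<cdot>\<^sub>m ?J) * ?M =
      four_block_mat (?x \<cdot>\<^sub>m ?I) ?b (0\<^sub>m 1 n) (- ?bt * ?b + (?x \<cdot>\<^sub>m ?J) * ?J)" .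
  have K: "- ?bt * ?b + (?x \<cdot>\<^sub>m ?J) * ?J \<in> carrier_mat 1 1" using c by simp
  have "det (four_block_mat ?I (0\<^sub>m n 1) (- ?bt) (?x \<cdot>\<^sub>m ?J)) = ?x"
    by (subst det_four_block_mat_upper_right_zero[OF c(3) refl c(9,10)]) simp
  moreover have "four_block_mat ?I (0\<^sub>m n 1) (- ?bt) (?x \<cdot>\<^sub>m ?J) \<in> carrier_mat (n + 1) (n + 1)"
    by (rule four_block_carrier_mat[OF c(3,10)])
  ultimately have "?x * det ?M = ?x ^ n * det (- ?bt * ?b + (?x \<cdot>\<^sub>m ?J) * ?J)"
    using arg_cong[OF two, of det] M det_four_block_mat_lower_left_zero[OF c(5,1) refl K]
    by (simp add: det_mult)
  also have "det (- ?bt * ?b + (?x \<cdot>\<^sub>m ?J) * ?J) = (- ?bt * ?b + (?x \<cdot>\<^sub>m ?J) * ?J) $$ (0, 0)"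
    using K by (simp add: det_single)
  also have "\<dots> = [:- ((transpose_mat b * b) $$ (0, 0)), 1:]"
    using b by (simp add: scalar_prod_def sum_negf sum_to_poly)
  finally show ?thesis using det1 by simp
qed

text \<open>
The eigenvalue equation in the row of an entry \<open>x \<sigma>\<close> of largest modulus, with off-diagonal
coefficients bounded by 1 and supported in \<open>M\<close>, bounds the eigenvalue by \<open>g \<sigma> + card M\<close>. If
the eigenvalue attains this bound, no term of the row loses anything in modulus or sign.
\<close>

lemma maximal_entry_row_equality:
  fixes g x :: "'b \<Rightarrow> real"
  assumes fin: "finite F" and \<sigma>: "\<sigma> \<in> F" "x \<sigma> \<noteq> 0"
    and max: "\<And>\<rho>. \<rho> \<in> F \<Longrightarrow> \<bar>x \<rho>\<bar> \<le> \<bar>x \<sigma>\<bar>"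
    and nb: "M \<subseteq> F - {\<sigma>}" "\<And>\<rho>. \<rho> \<in> M \<Longrightarrow> \<bar>g \<rho>\<bar> \<le> 1"
      "\<And>\<rho>. \<rho> \<in> F - {\<sigma>} - M \<Longrightarrow> g \<rho> = 0"
    and row: "(\<Sum>\<rho>\<in>F. g \<rho> * x \<rho>) = k * x \<sigma>"
    and k: "g \<sigma> + real (card M) \<le> k"
  shows "k = g \<sigma> + card M" "\<And>\<rho>. \<rho> \<in> M \<Longrightarrow> g \<rho> * x \<rho> = x \<sigma>"
proof -
  \<comment> \<open>The loss of the term at \<open>\<rho>\<close>, multiplied by \<open>x \<sigma>\<close> so that it is nonnegative for either sign.\<close>
  define e where "e \<rho> = x \<sigma> * (x \<sigma> - g \<rho> * x \<rho>)" for \<rho>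
  have finM: "finite M" using fin nb(1) finite_subset by blast
  have e: "0 \<le> e \<rho>" if "\<rho> \<in> M" for \<rho>
  proof -
    have "\<bar>g \<rho> * x \<rho>\<bar> \<le> 1 * \<bar>x \<sigma>\<bar>"
      unfolding abs_mult by (rule mult_mono) (use nb that max in auto)
    then show ?thesis unfolding e_def zero_le_mult_iff by linarith
  qed
  have "(\<Sum>\<rho>\<in>F. g \<rho> * x \<rho>) = g \<sigma> * x \<sigma> + (\<Sum>\<rho>\<in>F - {\<sigma>}. g \<rho> * x \<rho>)"
    using fin \<sigma> by (simp add: sum.remove)
  also have "(\<Sum>\<rho>\<in>F - {\<sigma>}. g \<rho> * x \<rho>) = (\<Sum>\<rho>\<in>M. g \<rho> * x \<rho>)"
    using fin nb by (intro sum.mono_neutral_right) auto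
  finally have s: "(\<Sum>\<rho>\<in>M. g \<rho> * x \<rho>) = (k - g \<sigma>) * x \<sigma>" using row by (simp add: algebra_simps)
  have "sum e M = x \<sigma> * (card M * x \<sigma> - (\<Sum>\<rho>\<in>M. g \<rho> * x \<rho>))"
    by (simp add: e_def sum_subtractf flip: sum_distrib_left)
  also have "\<dots> = (g \<sigma> + card M - k) * (x \<sigma>)\<^sup>2"
    unfolding s by (simp add: algebra_simps power2_eq_square)
  finally have sum: "sum e M = (g \<sigma> + card M - k) * (x \<sigma>)\<^sup>2" .
  moreover have "0 \<le> sum e M" using e by (rule sum_nonneg)
  moreover have x2: "0 < (x \<sigma>)\<^sup>2" using \<sigma> by simp
  ultimately have "0 \<le> g \<sigma> + card M - k" by (simp add: zero_le_mult_iff)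
  then show k': "k = g \<sigma> + card M" using k by simp
  then have "sum e M = 0" using sum by simp
  then have "e \<rho> = 0" if "\<rho> \<in> M" for \<rho>
    using that e sum_nonneg_eq_0_iff[OF finM, of e] by blast
  then show "g \<rho> * x \<rho> = x \<sigma>" if "\<rho> \<in> M" for \<rho>
    using that \<sigma>(2) by (simp add: e_def)
qed

lemma rev_sorted_list_of_multiset_replicate_mset:
  fixes c :: "'a :: linorder"
  assumes "a < c"
  shows "rev (sorted_list_of_multiset (add_mset c (replicate_mset n a))) = c # replicate n a"
proof -
  have "sorted_list_of_multiset (add_mset c (replicate_mset n a)) = sort (replicate n a @ [c])"
    by (metis mset.simps(1,2) mset_append mset_replicate sorted_list_of_multiset_mset add_mset_add_single)
  also have "\<dots> = replicate n a @ [c]"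
    by (rule sorted_sort_id) (use assms in \<open>auto simp: sorted_append\<close>)
  finally show ?thesis by simp
qed

section \<open>The spectrum of the up-Laplacian\<close>

lemma simplex_list:
  assumes "finite (simplices X k)"
  shows "distinct (simplex_list X k)" "set (simplex_list X k) = simplices X k"
  using someI_ex[of "\<lambda>xs. distinct xs \<and> set xs = simplices X k"] finite_distinct_list[OF assms]
  unfolding simplex_list_def by blast+

lemma up_laplacian_carrier:
  "up_laplacian ornt X k \<in> carrier_mat (length (simplex_list X k)) (length (simplex_list X k))"
  unfolding up_laplacian_def
  by (rule mult_carrier_mat[of _ _ "length (simplex_list X (k + 1))"])
    (simp_all add: boundary_matrix_def)

lemma set_decreasing_eigenvalues:
  assumes "A \<in> carrier_mat n n"
  shows "set (decreasing_eigenvalues A) = {k. eigenvalue A k}"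
proof -
  have "char_poly A \<noteq> 0" using degree_monic_char_poly[OF assms] by (metis coeff_0 zero_neq_one)
  then show ?thesis
    by (simp add: decreasing_eigenvalues_def eigenvalue_root_char_poly[OF assms])
qed

lemma eigenvalue_if_laplacian_eigenvalue:
  assumes "laplacian_eigenvalue ornt X k j = c" "c \<noteq> 0"
  shows "eigenvalue (up_laplacian ornt X k) c"
proof -
  let ?es = "decreasing_eigenvalues (up_laplacian ornt X k)"
  have "c \<in> set ?es"
    using assms by (auto simp: laplacian_eigenvalue_def Let_def split: if_splits)
  then show ?thesis by (simp add: set_decreasing_eigenvalues[OF up_laplacian_carrier])
qed

lemma laplacian_eigenvalue_if_eigenvalue:
  assumes "eigenvalue (up_laplacian ornt X k) c"
  obtains j where "1 \<le> j" "laplacian_eigenvalue ornt X k j = c"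
proof -
  let ?es = "decreasing_eigenvalues (up_laplacian ornt X k)"
  have "c \<in> set ?es" using assms by (simp add: set_decreasing_eigenvalues[OF up_laplacian_carrier])
  then obtain i where "i < length ?es" "?es ! i = c" by (metis in_set_conv_nth)
  then show ?thesis by (intro that[of "Suc i"]) (simp_all add: laplacian_eigenvalue_def)
qed

text \<open>
The entries of \<open>B\<^sup>T B\<close>, where \<open>B\<close> is the boundary matrix.
\<close>

definition simplex_overlap :: "('a set \<Rightarrow> 'a list) \<Rightarrow> 'a set set \<Rightarrow> nat \<Rightarrow> 'a set \<Rightarrow> 'a set \<Rightarrow> real" where
  "simplex_overlap ornt X k \<sigma> \<rho> =
     (\<Sum>\<tau>\<in>simplices X k. incidence ornt \<sigma> \<tau> * incidence ornt \<rho> \<tau>)"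

lemma eigenvalue_up_laplacian_iff:
  assumes fin: "finite X" and "c \<noteq> 0"
  shows "eigenvalue (up_laplacian ornt X k) c \<longleftrightarrow>
    (\<exists>x. (\<exists>\<sigma>\<in>simplices X (k + 1). x \<sigma> \<noteq> 0) \<and>
      (\<forall>\<sigma>\<in>simplices X (k + 1).
        (\<Sum>\<rho>\<in>simplices X (k + 1). simplex_overlap ornt X k \<sigma> \<rho> * x \<rho>) = c * x \<sigma>))"
proof -
  let ?xs = "simplex_list X (k + 1)" and ?ys = "simplex_list X k"
  let ?B = "boundary_matrix ornt X (k + 1)"
  have fin': "finite (simplices X l)" for l using fin by (simp add: simplices_def)
  note xs = simplex_list[OF fin', of "k + 1"] and ys = simplex_list[OF fin', of k]
  have B: "?B \<in> carrier_mat (length ?ys) (length ?xs)"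
    "transpose_mat ?B \<in> carrier_mat (length ?xs) (length ?ys)"
    by (simp_all add: boundary_matrix_def)
  have "transpose_mat ?B * ?B =
      mat (length ?xs) (length ?xs) (\<lambda>(i, j). simplex_overlap ornt X k (?xs ! i) (?xs ! j))"
  proof (rule eq_matI)
    fix i j
    assume "i < dim_row (mat (length ?xs) (length ?xs)
        (\<lambda>(i, j). simplex_overlap ornt X k (?xs ! i) (?xs ! j)))"
      "j < dim_col (mat (length ?xs) (length ?xs)
        (\<lambda>(i, j). simplex_overlap ornt X k (?xs ! i) (?xs ! j)))"
    then have ij: "i < length ?xs" "j < length ?xs" by simp_all
    then have "(transpose_mat ?B * ?B) $$ (i, j) =
        (\<Sum>l<length ?ys. incidence ornt (?xs ! i) (?ys ! l) * incidence ornt (?xs ! j) (?ys ! l))"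
      by (simp add: boundary_matrix_def scalar_prod_def atLeast0LessThan)
    also have "\<dots> = simplex_overlap ornt X k (?xs ! i) (?xs ! j)"
      unfolding simplex_overlap_def ys(2)[symmetric] by (rule sum_nth_eq_sum_set[OF ys(1)])
    finally show "(transpose_mat ?B * ?B) $$ (i, j) = mat (length ?xs) (length ?xs)
        (\<lambda>(i, j). simplex_overlap ornt X k (?xs ! i) (?xs ! j)) $$ (i, j)" using ij by simp
  qed (simp_all add: boundary_matrix_def)
  moreover have "eigenvalue (?B * transpose_mat ?B) c \<longleftrightarrow> eigenvalue (transpose_mat ?B * ?B) c"
    using eigenvalue_mult_commute[OF B \<open>c \<noteq> 0\<close>] eigenvalue_mult_commute[OF B(2,1) \<open>c \<noteq> 0\<close>] by blast
  ultimately show ?thesis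
    unfolding up_laplacian_def using eigenvalue_indexed_mat_iff[OF xs(1)] xs(2) by simp
qed

lemma incidence_square_simplices:
  assumes "orientation X ornt" "\<sigma> \<in> simplices X (k + 1)" "\<tau> \<in> simplices X k"
  shows "(incidence ornt \<sigma> \<tau>)\<^sup>2 = (if \<tau> \<subseteq> \<sigma> then 1 else 0)"
  by (rule incidence_square) (use assms in \<open>auto simp: orientation_def simplices_def\<close>)

lemma facet_in_simplices:
  assumes "simplicial_complex V X" "\<sigma> \<in> X" "\<tau> \<subseteq> \<sigma>" "card \<tau> = k + 1"
  shows "\<tau> \<in> simplices X k"
  using assms by (auto simp: simplicial_complex_def simplices_def)

lemma simplex_finite:
  assumes "simplicial_complex V X"
  shows "finite X" "\<sigma> \<in> X \<Longrightarrow> finite \<sigma>"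
proof -
  have "finite (Pow V)" "X \<subseteq> Pow V" using assms by (auto simp: simplicial_complex_def)
  then show "finite X" by (rule rev_finite_subset)
  show "finite \<sigma>" if "\<sigma> \<in> X"
    using that assms by (auto simp: simplicial_complex_def intro: finite_subset)
qed

text \<open>
The sum counts the \<open>k + 2\<close> ridges of \<open>\<sigma>\<close>.
\<close>

lemma simplex_overlap_self:
  assumes X: "simplicial_complex V X" "orientation X ornt" and \<sigma>: "\<sigma> \<in> simplices X (k + 1)"
  shows "simplex_overlap ornt X k \<sigma> \<sigma> = k + 2"
proof -
  have mem: "\<sigma> \<in> X" "card \<sigma> = k + 2" using \<sigma> by (auto simp: simplices_def)
  have fin: "finite (simplices X k)" using simplex_finite[OF X(1)] by (simp add: simplices_def)
  have "simplex_overlap ornt X k \<sigma> \<sigma> = (\<Sum>\<tau>\<in>simplices X k. if \<tau> \<subseteq> \<sigma> then 1 else 0)"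
    unfolding simplex_overlap_def
    by (rule sum.cong) (simp_all add: incidence_square_simplices[OF X(2) \<sigma>] flip: power2_eq_square)
  also have "\<dots> = real (card {\<tau> \<in> simplices X k. \<tau> \<subseteq> \<sigma>})"
    using fin by (simp add: sum.If_cases Int_def)
  also have "{\<tau> \<in> simplices X k. \<tau> \<subseteq> \<sigma>} = {\<tau>. \<tau> \<subseteq> \<sigma> \<and> card \<tau> = k + 1}"
    using facet_in_simplices[OF X(1) mem(1)] by (auto simp: simplices_def)
  also have "card \<dots> = k + 2"
    using n_subsets[OF simplex_finite(2)[OF X(1) mem(1)], of "k + 1"]
      binomial_Suc_n[of "k + 1"] mem(2) by simp
  finally show ?thesis by simp
qed

text \<open>
Distinct simplices have at most one common ridge, namely their intersection.
\<close>

lemma simplex_overlap_distinct: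
  assumes X: "simplicial_complex V X" "orientation X ornt"
    and \<sigma>: "\<sigma> \<in> simplices X (k + 1)" and \<rho>: "\<rho> \<in> simplices X (k + 1)" and "\<sigma> \<noteq> \<rho>"
  shows "\<bar>simplex_overlap ornt X k \<sigma> \<rho>\<bar> \<le> 1"
    and "card (\<sigma> \<inter> \<rho>) \<noteq> k + 1 \<Longrightarrow> simplex_overlap ornt X k \<sigma> \<rho> = 0"
proof -
  let ?t = "\<lambda>\<tau>. incidence ornt \<sigma> \<tau> * incidence ornt \<rho> \<tau>"
  have fin: "finite \<sigma>" "finite \<rho>" "finite (simplices X k)"
    using simplex_finite[OF X(1)] \<sigma> \<rho> by (auto simp: simplices_def)
  have "\<not> \<sigma> \<subseteq> \<rho>"
    using \<open>\<sigma> \<noteq> \<rho>\<close> fin(2) \<sigma> \<rho> card_subset_eq[of \<rho> \<sigma>] by (auto simp: simplices_def)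
  then have "card (\<sigma> \<inter> \<rho>) < card \<sigma>" using fin(1) by (intro psubset_card_mono) auto
  then have le: "card (\<sigma> \<inter> \<rho>) \<le> k + 1" using \<sigma> by (simp add: simplices_def)
  have sq: "(?t \<tau>)\<^sup>2 = (if \<tau> \<subseteq> \<sigma> \<inter> \<rho> then 1 else 0)" if "\<tau> \<in> simplices X k" for \<tau>
    using incidence_square_simplices[OF X(2) \<sigma> that] incidence_square_simplices[OF X(2) \<rho> that]
    by (simp add: power_mult_distrib)
  have zero: "?t \<tau> = 0" if "\<tau> \<in> simplices X k" "\<tau> \<noteq> \<sigma> \<inter> \<rho> \<or> card (\<sigma> \<inter> \<rho>) \<noteq> k + 1" for \<tau>
  proof -
    have "\<not> \<tau> \<subseteq> \<sigma> \<inter> \<rho>"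
    proof
      assume sub: "\<tau> \<subseteq> \<sigma> \<inter> \<rho>"
      have "card \<tau> = k + 1" using that(1) by (simp add: simplices_def)
      then have "card (\<sigma> \<inter> \<rho>) = card \<tau>"
        using card_mono[OF _ sub] fin(1) le by simp
      then show False using card_subset_eq[OF _ sub] fin(1) that(2) \<open>card \<tau> = k + 1\<close> by auto
    qed
    then have "(?t \<tau>)\<^sup>2 = 0" using sq[OF that(1)] by simp
    then show ?thesis by simp
  qed
  show "simplex_overlap ornt X k \<sigma> \<rho> = 0" if "card (\<sigma> \<inter> \<rho>) \<noteq> k + 1"
    unfolding simplex_overlap_def using zero that by (intro sum.neutral) blast
  show "\<bar>simplex_overlap ornt X k \<sigma> \<rho>\<bar> \<le> 1"
  proof (cases "\<sigma> \<inter> \<rho> \<in> simplices X k")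
    case True
    have "simplex_overlap ornt X k \<sigma> \<rho> = ?t (\<sigma> \<inter> \<rho>)"
      unfolding simplex_overlap_def using zero
      by (subst sum.remove[OF fin(3) True]) (simp add: sum.neutral)
    moreover have "(?t (\<sigma> \<inter> \<rho>))\<^sup>2 = 1" using sq[OF True] by simp
    ultimately show ?thesis by (auto simp: power2_eq_1_iff)
  next
    case False
    then have "simplex_overlap ornt X k \<sigma> \<rho> = 0"
      unfolding simplex_overlap_def using zero by (intro sum.neutral) blast
    then show ?thesis by simp
  qed
qed

lemma conjugate_degree_1_eq_card_shadow:
  assumes X: "simplicial_complex V X"
  shows "conjugate_degree X k 1 = card (shadow (k + 1) (simplices X (k + 1)))"
proof -
  have fin: "finite (simplices X (k + 1))"
    using simplex_finite[OF X] by (simp add: simplices_def)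
  have "{\<tau> \<in> simplices X k. 1 \<le> up_degree X k \<tau>} = shadow (k + 1) (simplices X (k + 1))"
  proof (intro Set.set_eqI)
    fix \<tau>
    have "1 \<le> up_degree X k \<tau> \<longleftrightarrow> (\<exists>\<sigma>\<in>simplices X (k + 1). \<tau> \<subseteq> \<sigma>)"
      using fin by (auto simp: up_degree_def Suc_le_eq card_gt_0_iff)
    then show "\<tau> \<in> {\<tau> \<in> simplices X k. 1 \<le> up_degree X k \<tau>} \<longleftrightarrow>
        \<tau> \<in> shadow (k + 1) (simplices X (k + 1))"
      using facet_in_simplices[OF X] by (auto simp: simplices_def shadow_def)
  qed
  then show ?thesis by (simp add: conjugate_degree_def)
qed

section \<open>Equality forces a single top-dimensional simplex\<close>

text \<open>
The equality discussion for an eigenvector \<open>x\<close> to the first conjugate degree \<open>N\<close>. The simplices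
at which \<open>x\<close> has its largest modulus form a neighbour-closed class of extremal simplices, so
only the four triangles on a 4-set remain to be excluded.
\<close>

lemma face_number_eq_1_if_spectrum_eq:
  assumes X: "simplicial_complex V X" "orientation X ornt"
    and k: "1 \<le> k" and ne: "simplices X (k + 1) \<noteq> {}"
    and spec: "spectrum_eq_conjugate_degrees ornt X k"
  shows "face_number X (k + 1) = 1"
proof (rule ccontr)
  assume not1: "face_number X (k + 1) \<noteq> 1"
  let ?F = "simplices X (k + 1)"
  let ?g = "simplex_overlap ornt X k"
  have finX: "finite X" and fin: "finite ?F"
    using simplex_finite[OF X(1)] by (auto simp: simplices_def)
  interpret uniform_family ?F "k + 1"
    by unfold_locales (use fin k in \<open>auto simp: simplices_def\<close>)
  have nb_iff: "\<rho> \<in> neighbours \<sigma> \<longleftrightarrow> \<rho> \<in> ?F \<and> card (\<sigma> \<inter> \<rho>) = k + 1" for \<sigma> \<rho>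
    unfolding neighbours_def by simp
  define N where "N = card (shadow (k + 1) ?F)"
  have lower: "k + 2 + card (neighbours \<sigma>) \<le> N" if "\<sigma> \<in> ?F" for \<sigma>
    using card_shadow_ge[OF that] by (simp add: N_def)
  have N2: "2 < N" using ne lower k by fastforce
  have "laplacian_eigenvalue ornt X k 1 = real N"
    using spec conjugate_degree_1_eq_card_shadow[OF X(1), of k]
    by (simp add: spectrum_eq_conjugate_degrees_def N_def)
  then have "eigenvalue (up_laplacian ornt X k) (real N)"
    by (rule eigenvalue_if_laplacian_eigenvalue) (use N2 in simp)
  then obtain x where nz: "\<exists>\<sigma>\<in>?F. x \<sigma> \<noteq> 0"
    and row: "\<And>\<sigma>. \<sigma> \<in> ?F \<Longrightarrow> (\<Sum>\<rho>\<in>?F. ?g \<sigma> \<rho> * x \<rho>) = real N * x \<sigma>"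
    using eigenvalue_up_laplacian_iff[OF finX, of "real N" ornt k] N2 by auto
  define m where "m = Max ((\<lambda>\<sigma>. \<bar>x \<sigma>\<bar>) ` ?F)"
  define M where "M = {\<sigma> \<in> ?F. \<bar>x \<sigma>\<bar> = m}"
  have le_m: "\<bar>x \<sigma>\<bar> \<le> m" if "\<sigma> \<in> ?F" for \<sigma> using that fin by (simp add: m_def)
  have m_pos: "0 < m" using nz le_m by (metis less_le_trans zero_less_abs_iff)
  have "m \<in> (\<lambda>\<sigma>. \<bar>x \<sigma>\<bar>) ` ?F" unfolding m_def using fin ne by (intro Max_in) auto
  then have M_ne: "M \<noteq> {}" by (auto simp: M_def)
  have M: "N = k + 2 + card (neighbours \<sigma>)"
    "\<And>\<rho>. \<rho> \<in> neighbours \<sigma> \<Longrightarrow> ?g \<sigma> \<rho> * x \<rho> = x \<sigma>" if "\<sigma> \<in> M" for \<sigma>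
  proof -
    have \<sigma>: "\<sigma> \<in> ?F" "x \<sigma> \<noteq> 0" "\<bar>x \<sigma>\<bar> = m" using that m_pos by (auto simp: M_def)
    have self: "\<sigma> \<notin> neighbours \<sigma>" using \<sigma>(1) unfolding nb_iff by (simp add: simplices_def)
    have nb: "neighbours \<sigma> \<subseteq> ?F - {\<sigma>}" using self nb_iff by blast
    have le1: "\<bar>?g \<sigma> \<rho>\<bar> \<le> 1" if "\<rho> \<in> neighbours \<sigma>" for \<rho>
      using simplex_overlap_distinct(1)[OF X \<sigma>(1)] that nb by blast
    have eq0: "?g \<sigma> \<rho> = 0" if "\<rho> \<in> ?F - {\<sigma>} - neighbours \<sigma>" for \<rho>
      using simplex_overlap_distinct(2)[OF X \<sigma>(1), of \<rho>] that unfolding Diff_iff nb_iff by blast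
    have le: "?g \<sigma> \<sigma> + real (card (neighbours \<sigma>)) \<le> real N"
      using lower[OF \<sigma>(1)] simplex_overlap_self[OF X \<sigma>(1)] by simp
    note eq = maximal_entry_row_equality[OF fin \<sigma>(1,2) _ nb le1 eq0 row[OF \<sigma>(1)] le]
    have "real N = ?g \<sigma> \<sigma> + card (neighbours \<sigma>)"
      by (rule eq(1)) (use le_m \<sigma>(3) in simp_all)
    then show "N = k + 2 + card (neighbours \<sigma>)"
      using simplex_overlap_self[OF X \<sigma>(1)] by simp
    show "?g \<sigma> \<rho> * x \<rho> = x \<sigma>" if "\<rho> \<in> neighbours \<sigma>" for \<rho>
      by (rule eq(2)) (use le_m \<sigma>(3) that in simp_all)
  qed
  have nb_M: "neighbours \<sigma> \<subseteq> M" if "\<sigma> \<in> M" for \<sigma>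
  proof
    fix \<rho> assume \<rho>: "\<rho> \<in> neighbours \<sigma>"
    have \<sigma>: "\<sigma> \<in> ?F" "\<bar>x \<sigma>\<bar> = m" using that by (auto simp: M_def)
    have \<rho>F: "\<rho> \<in> ?F" "\<sigma> \<noteq> \<rho>" using \<rho> \<sigma> unfolding nb_iff by (auto simp: simplices_def)
    have "m = \<bar>?g \<sigma> \<rho>\<bar> * \<bar>x \<rho>\<bar>" using M(2)[OF that \<rho>] \<sigma>(2) by (metis abs_mult)
    also have "\<dots> \<le> 1 * \<bar>x \<rho>\<bar>"
      by (rule mult_right_mono) (use simplex_overlap_distinct(1)[OF X \<sigma>(1) \<rho>F] in auto)
    finally show "\<rho> \<in> M" using le_m[OF \<rho>F(1)] \<rho>F by (simp add: M_def)
  qed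
  have "M \<subseteq> ?F" by (auto simp: M_def)
  moreover have "extremal \<sigma>" if "\<sigma> \<in> M" for \<sigma>
    using M(1)[OF that] unfolding extremal_def N_def by simp
  ultimately obtain T where T: "card T = 4" "k + 1 = 2" "?F = {\<rho>. \<rho> \<subseteq> T \<and> card \<rho> = 3}" "M = ?F"
    using extremal_class[OF _ _ nb_M M_ne] not1 by (metis face_number_def)
  have finT: "finite T" using T(1) by (simp add: card_ge_0_finite)
  have adj: "?g \<sigma> \<rho> * x \<rho> = x \<sigma>" if "\<sigma> \<in> ?F" "\<rho> \<in> ?F" "\<sigma> \<noteq> \<rho>" for \<sigma> \<rho>
  proof -
    have c: "\<sigma> \<subseteq> T" "\<rho> \<subseteq> T" "card \<sigma> = 3" "card \<rho> = 3" using that T(3) by auto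
    have f: "finite \<sigma>" "finite \<rho>" using c finT finite_subset by blast+
    have "\<not> \<rho> \<subseteq> \<sigma>" using that(3) c f card_subset_eq by metis
    then have "card \<sigma> < card (\<sigma> \<union> \<rho>)" using f by (intro psubset_card_mono) auto
    moreover have "card (\<sigma> \<union> \<rho>) \<le> 4" using c finT T(1) by (metis Un_least card_mono)
    ultimately have "card (\<sigma> \<inter> \<rho>) = 2" using card_Un_Int[OF f] c by simp
    then have "\<rho> \<in> neighbours \<sigma>" unfolding nb_iff using that(2) T(2) by simp
    then show ?thesis using M(2) T(4) that by blast
  qed
  have "1 < card ?F" using not1 ne fin card_gt_0_iff[of ?F] by (simp add: face_number_def)
  then obtain \<alpha> \<beta> where \<alpha>\<beta>: "\<alpha> \<in> ?F" "\<beta> \<in> ?F" "\<alpha> \<noteq> \<beta>"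
    by (metis card_le_Suc0_iff_eq fin linorder_not_less One_nat_def)
  have nonzero: "x \<sigma> \<noteq> 0" if "\<sigma> \<in> ?F" for \<sigma> using that T(4) m_pos by (auto simp: M_def)
  \<comment> \<open>By \<open>adj\<close>, the contributions of \<open>\<alpha>\<close> and \<open>\<beta>\<close> cancel in all other rows, and in their own
    rows they combine to \<open>(3 - 1) * x \<alpha>\<close> and \<open>(1 - 3) * x \<beta>\<close>.\<close>
  define y where "y \<rho> = (if \<rho> = \<alpha> then x \<alpha> else if \<rho> = \<beta> then - x \<beta> else 0)" for \<rho>
  have "(\<Sum>\<rho>\<in>?F. ?g \<sigma> \<rho> * y \<rho>) = 2 * y \<sigma>" if \<sigma>: "\<sigma> \<in> ?F" for \<sigma>
  proof -
    have self: "?g \<sigma> \<sigma> = 3" using simplex_overlap_self[OF X \<sigma>] T(2) by simp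
    have "(\<Sum>\<rho>\<in>?F. ?g \<sigma> \<rho> * y \<rho>) = (\<Sum>\<rho>\<in>{\<alpha>, \<beta>}. ?g \<sigma> \<rho> * y \<rho>)"
      by (rule sum.mono_neutral_right) (use fin \<alpha>\<beta> in \<open>auto simp: y_def\<close>)
    also have "\<dots> = ?g \<sigma> \<alpha> * x \<alpha> - ?g \<sigma> \<beta> * x \<beta>" using \<alpha>\<beta>(3) by (simp add: y_def)
    also have "\<dots> = 2 * y \<sigma>"
      using adj[OF \<sigma> \<alpha>\<beta>(1)] adj[OF \<sigma> \<alpha>\<beta>(2)] self \<alpha>\<beta>(3)
      by (cases "\<sigma> = \<alpha>"; cases "\<sigma> = \<beta>") (auto simp: y_def)
    finally show ?thesis .
  qed
  moreover have "y \<alpha> \<noteq> 0" using nonzero[OF \<alpha>\<beta>(1)] by (simp add: y_def)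
  ultimately have "eigenvalue (up_laplacian ornt X k) 2"
    using eigenvalue_up_laplacian_iff[OF finX, of 2 ornt k] \<alpha>\<beta>(1) by auto
  then obtain j where j: "1 \<le> j" "laplacian_eigenvalue ornt X k j = 2"
    by (rule laplacian_eigenvalue_if_eigenvalue)
  then have two: "conjugate_degree X k j = 2"
    using spec by (metis of_nat_eq_iff of_nat_numeral spectrum_eq_conjugate_degrees_def)
  \<comment> \<open>A covered edge \<open>\<tau>\<close> of the 4-set \<open>T\<close> extends to a triangle by either of the two other vertices.\<close>
  have deg: "up_degree X k \<tau> = 2" if "\<tau> \<in> shadow (k + 1) ?F" for \<tau>
  proof -
    have \<tau>: "card \<tau> = 2" "\<tau> \<subseteq> T" using that T(2,3) by (auto simp: shadow_def)
    then have f\<tau>: "finite \<tau>" using finT finite_subset by blast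
    have "{\<rho> \<in> ?F. \<tau> \<subseteq> \<rho>} = (\<lambda>c. insert c \<tau>) ` (T - \<tau>)"
    proof (intro Set.set_eqI iffI)
      fix \<rho> assume "\<rho> \<in> {\<rho> \<in> ?F. \<tau> \<subseteq> \<rho>}"
      then have \<rho>: "\<rho> \<subseteq> T" "card \<rho> = 3" "\<tau> \<subseteq> \<rho>" using T(3) by auto
      then have "card (\<rho> - \<tau>) = 1" using \<tau> f\<tau> by (simp add: card_Diff_subset)
      then obtain c where "\<rho> - \<tau> = {c}" by (auto simp: card_1_singleton_iff)
      then have "\<rho> = insert c \<tau>" "c \<in> T - \<tau>" using \<rho> by auto
      then show "\<rho> \<in> (\<lambda>c. insert c \<tau>) ` (T - \<tau>)" by blast
    next
      fix \<rho> assume "\<rho> \<in> (\<lambda>c. insert c \<tau>) ` (T - \<tau>)"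
      then obtain c where c: "c \<in> T - \<tau>" "\<rho> = insert c \<tau>" by blast
      then have "\<rho> \<subseteq> T" "card \<rho> = 3" "\<tau> \<subseteq> \<rho>" using \<tau> f\<tau> by auto
      then show "\<rho> \<in> {\<rho> \<in> ?F. \<tau> \<subseteq> \<rho>}" using T(3) by blast
    qed
    moreover have "card ((\<lambda>c. insert c \<tau>) ` (T - \<tau>)) = card (T - \<tau>)"
      by (rule card_image) (auto simp: inj_on_def)
    moreover have "card (T - \<tau>) = 2" using \<tau> f\<tau> T(1) by (simp add: card_Diff_subset)
    ultimately show ?thesis by (simp add: up_degree_def)
  qed
  have deg0: "up_degree X k \<tau> = 0" if "\<tau> \<in> simplices X k" "\<tau> \<notin> shadow (k + 1) ?F" for \<tau>
  proof -
    have "{F \<in> ?F. \<tau> \<subseteq> F} = {}" using that by (auto simp: shadow_def simplices_def)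
    then show ?thesis by (metis card.empty up_degree_def)
  qed
  have "shadow (k + 1) ?F \<subseteq> simplices X k"
    using facet_in_simplices[OF X(1)] by (auto simp: shadow_def simplices_def)
  then have "\<tau> \<in> simplices X k \<and> j \<le> up_degree X k \<tau> \<longleftrightarrow> \<tau> \<in> shadow (k + 1) ?F \<and> j \<le> 2" for \<tau>
    using deg[of \<tau>] deg0[of \<tau>] j(1) by (cases "\<tau> \<in> shadow (k + 1) ?F") auto
  then have "conjugate_degree X k j = card {\<tau> \<in> shadow (k + 1) ?F. j \<le> 2}"
    unfolding conjugate_degree_def by (simp only:)
  then have "conjugate_degree X k j \<in> {0, N}" unfolding N_def by (cases "j \<le> 2") simp_all
  then show False using two N2 by simp
qed

section \<open>A single top-dimensional simplex\<close>

text \<open>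
The boundary matrix is one column \<open>b\<close> with \<open>b\<^sup>T b = k + 2\<close>, so the Laplacian is the outer
product \<open>b b\<^sup>T\<close>.
\<close>

lemma decreasing_eigenvalues_single_simplex:
  assumes X: "simplicial_complex V X" "orientation X ornt"
    and one: "face_number X (k + 1) = 1"
  shows "decreasing_eigenvalues (up_laplacian ornt X k) =
    real (k + 2) # replicate (length (simplex_list X k) - 1) 0"
proof -
  let ?F = "simplices X (k + 1)" let ?n = "length (simplex_list X k)"
  let ?B = "boundary_matrix ornt X (k + 1)"
  obtain \<sigma> where F: "?F = {\<sigma>}" using one by (auto simp: face_number_def card_1_singleton_iff)
  have fin: "finite (simplices X l)" for l
    using simplex_finite[OF X(1)] by (simp add: simplices_def)
  note xs = simplex_list[OF fin, of "k + 1"] and ys = simplex_list[OF fin, of k]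
  have "length (simplex_list X (k + 1)) = card {\<sigma>}"
    using distinct_card[OF xs(1)] unfolding xs(2) F by (rule sym)
  then have len: "length (simplex_list X (k + 1)) = 1" by simp
  then obtain \<rho> where "simplex_list X (k + 1) = [\<rho>]"
    by (metis One_nat_def length_0_conv length_Suc_conv)
  then have list: "simplex_list X (k + 1) = [\<sigma>]" using xs(2) unfolding F by simp
  have B_eq: "?B = mat ?n 1 (\<lambda>(i, j). incidence ornt ([\<sigma>] ! j) (simplex_list X k ! i))"
    unfolding boundary_matrix_def list by simp
  have B: "?B \<in> carrier_mat ?n 1" unfolding B_eq by simp
  have "(transpose_mat ?B * ?B) $$ (0, 0) =
      (\<Sum>l<?n. incidence ornt \<sigma> (simplex_list X k ! l) * incidence ornt \<sigma> (simplex_list X k ! l))"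
    unfolding B_eq by (simp add: scalar_prod_def atLeast0LessThan)
  also have "\<dots> = simplex_overlap ornt X k \<sigma> \<sigma>"
    unfolding simplex_overlap_def ys(2)[symmetric] by (rule sum_nth_eq_sum_set[OF ys(1)])
  also have "\<dots> = real (k + 2)" using simplex_overlap_self[OF X, of \<sigma> k] F by simp
  finally have norm: "(transpose_mat ?B * ?B) $$ (0, 0) = real (k + 2)" .
  have "\<exists>\<tau>\<subseteq>\<sigma>. card \<tau> = k + 1"
  proof -
    have "card \<sigma> = k + 2" using F by (auto simp: simplices_def)
    then show ?thesis by (metis add_le_cancel_left obtain_subset_with_card_n one_le_numeral)
  qed
  then have "simplices X k \<noteq> {}"
    using F facet_in_simplices[OF X(1), of \<sigma> _ k] by (auto simp: simplices_def)
  then have n: "?n \<noteq> 0" using ys by auto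
  have "[:0, 1:] * char_poly (up_laplacian ornt X k) =
      [:0, 1:] * ([:0, 1:] ^ (?n - 1) * [:- real (k + 2), 1:])"
    unfolding up_laplacian_def char_poly_outer_product[OF B] norm
    using n by (cases ?n) (simp_all add: algebra_simps)
  then have cp: "char_poly (up_laplacian ornt X k) = [:0, 1:] ^ (?n - 1) * [:- real (k + 2), 1:]"
    by (metis mult_left_cancel pCons_eq_0_iff zero_neq_one)
  have "proots (char_poly (up_laplacian ornt X k)) =
      add_mset (real (k + 2)) (replicate_mset (?n - 1) 0)"
    unfolding cp by (subst proots_mult) (simp_all add: proots_power repeat_mset_replicate_mset)
  then show ?thesis
    unfolding decreasing_eigenvalues_def
    by (simp only:) (rule rev_sorted_list_of_multiset_replicate_mset, simp)
qed

lemma spectrum_eq_if_face_number_eq_1: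
  assumes X: "simplicial_complex V X" "orientation X ornt"
    and one: "face_number X (k + 1) = 1"
  shows "spectrum_eq_conjugate_degrees ornt X k"
  unfolding spectrum_eq_conjugate_degrees_def
proof (intro allI impI)
  fix j :: nat assume j: "1 \<le> j"
  let ?F = "simplices X (k + 1)"
  obtain \<sigma> where F: "?F = {\<sigma>}" using one by (auto simp: face_number_def card_1_singleton_iff)
  have \<sigma>: "\<sigma> \<in> X" "card \<sigma> = k + 2" using F by (auto simp: simplices_def)
  show "laplacian_eigenvalue ornt X k j = real (conjugate_degree X k j)"
  proof (cases "j = 1")
    case True
    have "shadow (k + 1) ?F = {\<tau>. \<tau> \<subseteq> \<sigma> \<and> card \<tau> = k + 1}" unfolding shadow_def F by auto
    then have "card (shadow (k + 1) ?F) = k + 2"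
      using n_subsets[OF simplex_finite(2)[OF X(1) \<sigma>(1)], of "k + 1"]
        binomial_Suc_n[of "k + 1"] \<sigma>(2) by simp
    then show ?thesis
      using True conjugate_degree_1_eq_card_shadow[OF X(1), of k]
      by (simp add: laplacian_eigenvalue_def decreasing_eigenvalues_single_simplex[OF assms])
  next
    case False
    have "up_degree X k \<tau> \<le> card {\<sigma>}" for \<tau>
      unfolding up_degree_def F by (rule card_mono) auto
    then have "up_degree X k \<tau> \<le> 1" for \<tau> by simp
    then have "{\<tau> \<in> simplices X k. j \<le> up_degree X k \<tau>} = {}"
      using False j by (metis (no_types, lifting) Collect_empty_eq le_antisym le_trans)
    then have "conjugate_degree X k j = 0"
      unfolding conjugate_degree_def by (simp only: card.empty)
    then show ?thesis
      using False j
      by (auto simp: laplacian_eigenvalue_def decreasing_eigenvalues_single_simplex[OF assms]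
          nth_Cons')
  qed
qed

section \<open>Pure complexes\<close>

lemma complex_dim_Max:
  assumes "simplicial_complex V X" "complex_dim X = int r"
  shows "\<sigma> \<in> X \<Longrightarrow> card \<sigma> \<le> r + 1" "simplices X r \<noteq> {}"
proof -
  have ne: "X \<noteq> {}" using assms(1) by (auto simp: simplicial_complex_def)
  have fin: "finite (simplex_dim ` X)" using simplex_finite[OF assms(1)] by simp
  have "int r \<in> simplex_dim ` X"
    using Max_in[OF fin] ne assms(2) by (simp add: complex_dim_def)
  then show "simplices X r \<noteq> {}" by (auto simp: simplex_dim_def simplices_def)
  show "card \<sigma> \<le> r + 1" if "\<sigma> \<in> X"
    using Max_ge[OF fin, of "simplex_dim \<sigma>"] that assms(2)
    by (simp add: complex_dim_def simplex_dim_def)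
qed

text \<open>
Every simplex lies in a maximal one, and the only maximal one is \<open>\<sigma>\<close> by purity.
\<close>

lemma pure_complex_eq_Pow:
  assumes X: "simplicial_complex V X" "pure_complex X"
    and dim: "complex_dim X = int r" and one: "simplices X r = {\<sigma>}"
  shows "X = Pow \<sigma>"
proof
  have \<sigma>: "\<sigma> \<in> X" using one by (auto simp: simplices_def)
  show "Pow \<sigma> \<subseteq> X" using X(1) \<sigma> by (auto simp: simplicial_complex_def)
  show "X \<subseteq> Pow \<sigma>"
  proof
    fix \<tau> assume "\<tau> \<in> X"
    then obtain \<mu> where \<mu>: "\<mu> \<in> X" "\<tau> \<subseteq> \<mu>" "\<forall>\<rho>\<in>X. \<mu> \<subseteq> \<rho> \<longrightarrow> \<rho> = \<mu>"
      using finite_has_maximal2[OF simplex_finite(1)[OF X(1)]] by metis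
    then have "simplex_dim \<mu> = int r" using X(2) dim by (auto simp: pure_complex_def)
    then have "\<mu> \<in> simplices X r" using \<mu>(1) by (simp add: simplices_def simplex_dim_def)
    then show "\<tau> \<in> Pow \<sigma>" using one \<mu>(2) by simp
  qed
qed

lemma complex_iso_full_simplex_Pow:
  assumes "finite \<sigma>" "card \<sigma> = r + 1"
  shows "complex_iso (Pow \<sigma>) (full_simplex r)"
proof -
  have v: "vertices (Pow \<sigma>) = \<sigma>" "vertices (full_simplex r) = {0..r}"
    by (auto simp: vertices_def full_simplex_def)
  obtain f where f: "bij_betw f \<sigma> {0..r}"
    using finite_same_card_bij[of \<sigma> "{0..r}"] assms by auto
  then have "f ` S \<subseteq> {0..r}" if "S \<subseteq> \<sigma>" for S using that by (auto simp: bij_betw_def)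
  then show ?thesis
    unfolding complex_iso_def v using f by (intro exI[of _ f]) (auto simp: full_simplex_def)
qed

text \<open>
Under the isomorphism the full vertex set corresponds to the simplex \<open>{0..r}\<close>, so it is itself
a simplex; having \<open>r + 1\<close> elements, it contains no other simplex of this size.
\<close>

lemma face_number_eq_1_if_iso_full_simplex:
  assumes X: "simplicial_complex V X" and iso: "complex_iso X (full_simplex r)"
  shows "face_number X r = 1"
proof -
  have v: "vertices (full_simplex r) = {0..r}" by (auto simp: vertices_def full_simplex_def)
  obtain f where f: "bij_betw f (vertices X) {0..r}"
    and sim: "\<And>S. S \<subseteq> vertices X \<Longrightarrow> S \<in> X \<longleftrightarrow> f ` S \<in> full_simplex r"
    using iso unfolding complex_iso_def v by blast
  have mem: "vertices X \<in> X" using sim[of "vertices X"] f by (simp add: bij_betw_def full_simplex_def)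
  have card: "card (vertices X) = r + 1" using bij_betw_same_card[OF f] by simp
  have "\<sigma> = vertices X" if "\<sigma> \<in> simplices X r" for \<sigma>
  proof (rule card_subset_eq)
    show "finite (vertices X)" using card by (simp add: card_ge_0_finite)
    show "\<sigma> \<subseteq> vertices X"
      using that X by (auto simp: simplicial_complex_def simplices_def vertices_def)
    show "card \<sigma> = card (vertices X)" using that card by (simp add: simplices_def)
  qed
  moreover have "vertices X \<in> simplices X r" using mem card by (simp add: simplices_def)
  ultimately have "simplices X r = {vertices X}" by blast
  then show ?thesis by (simp add: face_number_def)
qed

theorem corollary2:
  fixes V :: "'a set" and X :: "'a set set" and r :: nat
    and ornt :: "'a set \<Rightarrow> 'a list"
  assumes "simplicial_complex V X"
    and "complex_dim X = int r"
    and "r \<ge> 2"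
    and "orientation X ornt"
  shows "(spectrum_eq_conjugate_degrees ornt X (r - 1) \<longleftrightarrow> face_number X r = 1) \<and>
         (pure_complex X \<longrightarrow>
            (spectrum_eq_conjugate_degrees ornt X (r - 1) \<longleftrightarrow> complex_iso X (full_simplex r)))"
proof -
  define k where "k = r - 1"
  have k: "1 \<le> k" "r = k + 1" using assms(3) by (auto simp: k_def)
  have spec: "spectrum_eq_conjugate_degrees ornt X k \<longleftrightarrow> face_number X r = 1"
    using face_number_eq_1_if_spectrum_eq[OF assms(1,4) k(1)]
      spectrum_eq_if_face_number_eq_1[OF assms(1,4)] complex_dim_Max(2)[OF assms(1,2)] k(2)
    by blast
  have "face_number X r = 1 \<longleftrightarrow> complex_iso X (full_simplex r)" if pure: "pure_complex X"
  proof
    assume "face_number X r = 1"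
    then obtain \<sigma> where \<sigma>: "simplices X r = {\<sigma>}"
      by (auto simp: face_number_def card_1_singleton_iff)
    then have "\<sigma> \<in> X" "card \<sigma> = r + 1" by (auto simp: simplices_def)
    then show "complex_iso X (full_simplex r)"
      using pure_complex_eq_Pow[OF assms(1) pure assms(2) \<sigma>] complex_iso_full_simplex_Pow
        simplex_finite(2)[OF assms(1)] by metis
  qed (rule face_number_eq_1_if_iso_full_simplex[OF assms(1)])
  with spec show ?thesis by (simp add: k_def)
qed

end
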